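(* If there are no fit $Q$-measures, then there is a Banach space $X$ with an $L$-orthogonal sequence such that $X^{**}$ contains no $L$-orthogonal element.
   Context: A measure here is a finitely additive function $\mu:\mathcal P(\omega)\to[0,+\infty)$ vanishing on finite sets. For $\delta>0$, $\mu$ is a $\delta$-fit $Q$-measure if for every partition $\{A_n:n\in\omega\}$ of $\omega$ into finite sets there are $A\subseteq\omega$ and $k\in\omega$ with $\mu(A)\ge\delta\,\mu(\omega)$ and $|A_n\cap A|\le k$ for all $n$. $\mu$ is a fit $Q$-measure if it is a $\delta$-fit $Q$-measure for every $\delta<\frac12$. For a Banach space $X$: a sequence $(x_n)\subseteq B_X$ is $L$-orthogonal if $\lim_n\|x+x_n\|=1+\|x\|$ for all $x\in X$; an element $x^{**}\in X^{**}$ is $L$-orthogonal if $\|x+x^{**}\|=1+\|x\|$ for all $x\in X$. *)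

theory Defs
  imports "HOL-Analysis.Analysis" "HOL-Library.Function_Algebras" "HOL-Library.Disjoint_Sets"
begin

section \<open>Fit Q-measures\<close>

definition fa_measure :: "(nat set \<Rightarrow> real) \<Rightarrow> bool" where
  "fa_measure \<mu> \<longleftrightarrow>
     (\<forall>A. 0 \<le> \<mu> A) \<and> Measure_Space.additive UNIV \<mu> \<and> (\<forall>A. finite A \<longrightarrow> \<mu> A = 0)"

definition delta_fit_Q_measure :: "real \<Rightarrow> (nat set \<Rightarrow> real) \<Rightarrow> bool" where
  "delta_fit_Q_measure \<delta> \<mu> \<longleftrightarrow>
     fa_measure \<mu> \<and>
     (\<forall>P :: nat \<Rightarrow> nat set.
        partition_on UNIV (range P) \<and> (\<forall>n. finite (P n)) \<longrightarrow>
        (\<exists>A k. \<mu> A \<ge> \<delta> * \<mu> UNIV \<and> (\<forall>n. card (P n \<inter> A) \<le> k)))"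

text \<open>
  The condition \<open>\<mu> UNIV \<noteq> 0\<close> is the usual convention that the zero measure is not counted:
  the zero measure satisfies all the other conditions (with \<open>A = {}\<close>), so without it fit
  Q-measures would exist trivially.
\<close>

definition fit_Q_measure :: "(nat set \<Rightarrow> real) \<Rightarrow> bool" where
  "fit_Q_measure \<mu> \<longleftrightarrow> \<mu> UNIV \<noteq> 0 \<and> (\<forall>\<delta>. 0 < \<delta> \<and> \<delta> < 1/2 \<longrightarrow> delta_fit_Q_measure \<delta> \<mu>)"

section \<open>Banach spaces with explicit carrier and norm\<close>

text \<open>
  To quantify existentially over Banach spaces, a real normed space is a linear subspace \<open>S\<close> of an
  ambient real vector space, with a norm \<open>N\<close> that matters on \<open>S\<close> only and is unrelated to any norm
  or topology of the ambient type. Real-valued functions with the pointwise operations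
  serve as ambient space, both for concrete spaces and for (iterated) duals. The functions on \<open>nat set\<close> have linear
  dimension \<open>2 ^ c\<close> (\<open>c\<close> the continuum), so every real Banach space of density at most \<open>2 ^ c\<close> is
  isometric to one carried by a subspace of them.
\<close>

instantiation "fun" :: (type, real_vector) real_vector
begin

definition scaleR_fun :: "real \<Rightarrow> ('a \<Rightarrow> 'b) \<Rightarrow> 'a \<Rightarrow> 'b" where
  "scaleR_fun c f = (\<lambda>x. c *\<^sub>R f x)"

instance
  by standard (simp_all add: scaleR_fun_def fun_eq_iff scaleR_add_right scaleR_add_left)

end

definition normed_space_on :: "'a::real_vector set \<Rightarrow> ('a \<Rightarrow> real) \<Rightarrow> bool" where
  "normed_space_on S N \<longleftrightarrow>
     subspace S \<and>
     (\<forall>x\<in>S. 0 \<le> N x) \<and>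
     (\<forall>x\<in>S. N x = 0 \<longleftrightarrow> x = 0) \<and>
     (\<forall>x\<in>S. \<forall>c. N (c *\<^sub>R x) = \<bar>c\<bar> * N x) \<and>
     (\<forall>x\<in>S. \<forall>y\<in>S. N (x + y) \<le> N x + N y)"

definition banach_space_on :: "'a::real_vector set \<Rightarrow> ('a \<Rightarrow> real) \<Rightarrow> bool" where
  "banach_space_on S N \<longleftrightarrow>
     normed_space_on S N \<and>
     (\<forall>x :: nat \<Rightarrow> 'a.
        (\<forall>n. x n \<in> S) \<and> (\<forall>e>0. \<exists>M. \<forall>m\<ge>M. \<forall>n\<ge>M. N (x m - x n) < e) \<longrightarrow>
        (\<exists>l\<in>S. (\<lambda>n. N (x n - l)) \<longlonglongrightarrow> 0))"

text \<open>
  Functionals on \<open>S\<close> are extended by 0 outside of \<open>S\<close>, so that distinct elements of the dual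
  are distinct as functions on \<open>S\<close>.
\<close>

definition dual_space :: "'a::real_vector set \<Rightarrow> ('a \<Rightarrow> real) \<Rightarrow> ('a \<Rightarrow> real) set" where
  "dual_space S N =
     {f. (\<forall>x. x \<notin> S \<longrightarrow> f x = 0) \<and>
         (\<forall>x\<in>S. \<forall>y\<in>S. f (x + y) = f x + f y) \<and>
         (\<forall>x\<in>S. \<forall>c. f (c *\<^sub>R x) = c * f x) \<and>
         (\<exists>C. \<forall>x\<in>S. \<bar>f x\<bar> \<le> C * N x)}"

definition dual_norm :: "'a::real_vector set \<Rightarrow> ('a \<Rightarrow> real) \<Rightarrow> ('a \<Rightarrow> real) \<Rightarrow> real" where
  "dual_norm S N f = (SUP x\<in>{x \<in> S. N x \<le> 1}. \<bar>f x\<bar>)"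

definition bidual_space ::
  "'a::real_vector set \<Rightarrow> ('a \<Rightarrow> real) \<Rightarrow> (('a \<Rightarrow> real) \<Rightarrow> real) set" where
  "bidual_space S N = dual_space (dual_space S N) (dual_norm S N)"

definition bidual_norm ::
  "'a::real_vector set \<Rightarrow> ('a \<Rightarrow> real) \<Rightarrow> (('a \<Rightarrow> real) \<Rightarrow> real) \<Rightarrow> real" where
  "bidual_norm S N = dual_norm (dual_space S N) (dual_norm S N)"

definition bidual_embed ::
  "'a::real_vector set \<Rightarrow> ('a \<Rightarrow> real) \<Rightarrow> 'a \<Rightarrow> (('a \<Rightarrow> real) \<Rightarrow> real)" where
  "bidual_embed S N x = (\<lambda>f. if f \<in> dual_space S N then f x else 0)"

section \<open>L-orthogonality\<close>

definition L_orthogonal_seq ::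
  "'a::real_vector set \<Rightarrow> ('a \<Rightarrow> real) \<Rightarrow> (nat \<Rightarrow> 'a) \<Rightarrow> bool" where
  "L_orthogonal_seq S N u \<longleftrightarrow>
     (\<forall>n. u n \<in> S \<and> N (u n) \<le> 1) \<and>
     (\<forall>x\<in>S. (\<lambda>n. N (x + u n)) \<longlonglongrightarrow> 1 + N x)"

definition L_orthogonal_elem ::
  "'a::real_vector set \<Rightarrow> ('a \<Rightarrow> real) \<Rightarrow> (('a \<Rightarrow> real) \<Rightarrow> real) \<Rightarrow> bool" where
  "L_orthogonal_elem S N F \<longleftrightarrow>
     F \<in> bidual_space S N \<and>
     (\<forall>x\<in>S. bidual_norm S N (bidual_embed S N x + F) = 1 + N x)"

end

theory Submission
  imports Defs
begin

text \<open>
  The space consists of vectors with sequence coordinates \<open>x\<^sub>n\<close> and a bounded family of further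
  coordinates \<open>x\<^sub>T\<close>, one for each locally finite graph \<open>T\<close> on the natural numbers; its norm is the
  supremum of \<open>\<bar>x\<^sub>T\<bar> + (\<Sum>n\<in>A. \<bar>x\<^sub>n\<bar>)\<close> over all \<open>T\<close> and all finite sets \<open>A\<close> independent in \<open>T\<close>.
  Adding a far away point to \<open>A\<close> keeps it independent, so the vectors \<open>e\<^sub>n\<close> are L-orthogonal.

  An L-orthogonal \<open>F\<close> acts on the sequence functionals as a signed finitely additive measure, and its
  variation is a fit Q-measure. For a partition into finite sets, let \<open>T\<close> join the points of each
  piece. L-orthogonality to \<open>\<plusminus>e\<^sub>T\<close> gives \<open>f\<^sub>1\<close>, \<open>f\<^sub>2\<close> in the dual ball with \<open>f\<^sub>1(e\<^sub>T)\<close>, \<open>- f\<^sub>2(e\<^sub>T)\<close>,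
  \<open>F f\<^sub>1\<close>, \<open>F f\<^sub>2\<close> all close to 1. In the mean of \<open>f\<^sub>1\<close> and \<open>f\<^sub>2\<close> the graph coordinates nearly cancel,
  so \<open>F\<close> is close to 1 on the sequence \<open>g\<close> of its values at the \<open>e\<^sub>n\<close>. As \<open>f\<^sub>i\<close> almost
  norms \<open>\<plusminus>e\<^sub>T\<close>, \<open>g\<close> is large at boundedly many points of each piece, and the set where it is
  large has variation close to 1.
\<close>

section \<open>Duals and L-orthogonal elements\<close>

lemma scaleR_fun_apply [simp]: "(c *\<^sub>R f) x = c *\<^sub>R f x"
  by (simp add: scaleR_fun_def)

lemma sum_fun_apply: "(\<Sum>i\<in>I. f i) x = (\<Sum>i\<in>I. f i x)"
  for f :: "'i \<Rightarrow> 'a \<Rightarrow> 'b::comm_monoid_add"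
  by (induction I rule: infinite_finite_induct) auto

section \<open>Functionals on a normed space given by carrier and norm\<close>

lemma normed_space_onD:
  assumes "normed_space_on S N"
  shows "subspace S" "x \<in> S \<Longrightarrow> 0 \<le> N x" "x \<in> S \<Longrightarrow> N x = 0 \<longleftrightarrow> x = 0"
    "x \<in> S \<Longrightarrow> N (c *\<^sub>R x) = \<bar>c\<bar> * N x"
    "x \<in> S \<Longrightarrow> y \<in> S \<Longrightarrow> N (x + y) \<le> N x + N y"
    "0 \<in> S" "N 0 = 0"
  using assms by (auto simp: normed_space_on_def subspace_0)

lemma dual_spaceD:
  assumes "f \<in> dual_space S N"
  shows "x \<notin> S \<Longrightarrow> f x = 0"
    "x \<in> S \<Longrightarrow> y \<in> S \<Longrightarrow> f (x + y) = f x + f y"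
    "x \<in> S \<Longrightarrow> f (c *\<^sub>R x) = c * f x"
  using assms by (auto simp: dual_space_def)

lemma dual_space_diff:
  assumes "subspace S" "f \<in> dual_space S N" "x \<in> S" "y \<in> S"
  shows "f (x - y) = f x - f y"
  using dual_spaceD(2)[OF assms(2,3), of "(-1) *\<^sub>R y"] dual_spaceD(3)[OF assms(2,4), of "-1"]
    subspace_scale[OF assms(1,4), of "-1"]
  by simp

lemma dual_space_sum:
  assumes "subspace S" "f \<in> dual_space S N" "finite I" "\<And>i. i \<in> I \<Longrightarrow> v i \<in> S"
  shows "f (\<Sum>i\<in>I. v i) = (\<Sum>i\<in>I. f (v i))"
  using assms(3,4)
proof (induction I)
  case empty
  show ?case
    using dual_spaceD(3)[OF assms(2) subspace_0[OF assms(1)], of 0] by simp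
next
  case (insert i I)
  then show ?case
    using dual_spaceD(2)[OF assms(2), of "v i" "\<Sum>i\<in>I. v i"] subspace_sum[OF assms(1), of I v]
    by simp
qed

lemma dual_norm_le:
  assumes "0 \<in> S" "N 0 = 0" "0 \<le> C" "\<And>x. x \<in> S \<Longrightarrow> \<bar>f x\<bar> \<le> C * N x"
  shows "dual_norm S N f \<le> C"
  unfolding dual_norm_def
proof (rule cSUP_least)
  show "{x \<in> S. N x \<le> 1} \<noteq> {}"
    using assms(1,2) by (auto intro!: exI[of _ 0])
next
  fix x assume "x \<in> {x \<in> S. N x \<le> 1}"
  then have "\<bar>f x\<bar> \<le> C * N x" "C * N x \<le> C * 1"
    using assms(3,4) by (auto intro: mult_left_mono simp del: mult_1_right)
  then show "\<bar>f x\<bar> \<le> C" by simp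
qed

lemma dual_norm_bdd:
  assumes "f \<in> dual_space S N" "\<And>x. x \<in> S \<Longrightarrow> 0 \<le> N x"
  shows "bdd_above ((\<lambda>x. \<bar>f x\<bar>) ` {x \<in> S. N x \<le> 1})"
proof -
  obtain C where C: "\<And>x. x \<in> S \<Longrightarrow> \<bar>f x\<bar> \<le> C * N x"
    using assms(1) unfolding dual_space_def by blast
  have "\<bar>f x\<bar> \<le> \<bar>C\<bar>" if x: "x \<in> S" "N x \<le> 1" for x
  proof -
    have "C * N x \<le> \<bar>C\<bar> * N x"
      by (rule mult_right_mono) (use x assms(2) in auto)
    also have "\<dots> \<le> \<bar>C\<bar> * 1"
      using x by (intro mult_left_mono) auto
    finally show ?thesis using C[OF x(1)] by simp
  qed
  then show ?thesis by (intro bdd_aboveI2) auto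
qed

lemma abs_le_dual_norm:
  assumes S: "normed_space_on S N" and f: "f \<in> dual_space S N" and x: "x \<in> S"
  shows "\<bar>f x\<bar> \<le> dual_norm S N f * N x"
proof (cases "x = 0")
  case True
  then show ?thesis
    using dual_spaceD(3)[OF f x, of 0] normed_space_onD(7)[OF S] by simp
next
  case False
  then have pos: "0 < N x"
    using normed_space_onD(2,3)[OF S x] by linarith
  define y where "y = inverse (N x) *\<^sub>R x"
  have "y \<in> S" "N y = 1"
    using x pos normed_space_onD(4)[OF S x] subspace_scale[OF normed_space_onD(1)[OF S] x]
    by (auto simp: y_def)
  then have "\<bar>f y\<bar> \<le> dual_norm S N f"
    unfolding dual_norm_def
    by (intro cSUP_upper dual_norm_bdd[OF f]) (use normed_space_onD[OF S] in auto)
  moreover have "f y = inverse (N x) * f x"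
    unfolding y_def by (rule dual_spaceD(3)[OF f x])
  ultimately show ?thesis
    using pos by (simp add: abs_mult field_simps)
qed

lemma dual_norm_nonneg:
  assumes S: "normed_space_on S N" and f: "f \<in> dual_space S N"
  shows "0 \<le> dual_norm S N f"
proof -
  have "\<bar>f 0\<bar> \<le> dual_norm S N f"
    unfolding dual_norm_def
    by (intro cSUP_upper dual_norm_bdd[OF f]) (use normed_space_onD(2,6,7)[OF S] in auto)
  then show ?thesis by linarith
qed

lemma dual_spaceI:
  assumes "\<And>x. x \<notin> S \<Longrightarrow> f x = 0"
    "\<And>x y. x \<in> S \<Longrightarrow> y \<in> S \<Longrightarrow> f (x + y) = f x + f y"
    "\<And>x c. x \<in> S \<Longrightarrow> f (c *\<^sub>R x) = c * f x"
    "\<And>x. x \<in> S \<Longrightarrow> \<bar>f x\<bar> \<le> C * N x"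
  shows "f \<in> dual_space S N"
  using assms unfolding dual_space_def by blast

lemma subspace_dual_space:
  assumes S: "normed_space_on S N"
  shows "subspace (dual_space S N)"
proof (rule subspaceI)
  show "0 \<in> dual_space S N"
    by (rule dual_spaceI[where C = 0]) auto
next
  fix f g assume f: "f \<in> dual_space S N" and g: "g \<in> dual_space S N"
  show "f + g \<in> dual_space S N"
  proof (rule dual_spaceI[where C = "dual_norm S N f + dual_norm S N g"])
    fix x assume x: "x \<in> S"
    show "\<bar>(f + g) x\<bar> \<le> (dual_norm S N f + dual_norm S N g) * N x"
      using abs_le_dual_norm[OF S f x] abs_le_dual_norm[OF S g x] by (simp add: algebra_simps)
  qed (use dual_spaceD[OF f] dual_spaceD[OF g] in \<open>auto simp: algebra_simps\<close>)
next
  fix c :: real and f assume f: "f \<in> dual_space S N"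
  show "c *\<^sub>R f \<in> dual_space S N"
  proof (rule dual_spaceI[where C = "\<bar>c\<bar> * dual_norm S N f"])
    fix x assume x: "x \<in> S"
    show "\<bar>(c *\<^sub>R f) x\<bar> \<le> \<bar>c\<bar> * dual_norm S N f * N x"
      using mult_left_mono[OF abs_le_dual_norm[OF S f x], of "\<bar>c\<bar>"]
      by (simp add: abs_mult algebra_simps)
  qed (use dual_spaceD[OF f] in \<open>auto simp: algebra_simps\<close>)
qed

text \<open>This makes every fact about a space and its dual available one level up, for the dual
  and the bidual.\<close>

lemma normed_space_on_dual:
  assumes S: "normed_space_on S N"
  shows "normed_space_on (dual_space S N) (dual_norm S N)"
  unfolding normed_space_on_def
proof (intro conjI ballI allI)
  show "subspace (dual_space S N)" by (rule subspace_dual_space[OF S])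
next
  fix f assume f: "f \<in> dual_space S N"
  show "0 \<le> dual_norm S N f" by (rule dual_norm_nonneg[OF S f])
  show "dual_norm S N f = 0 \<longleftrightarrow> f = 0"
  proof
    assume 0: "dual_norm S N f = 0"
    show "f = 0"
    proof
      fix x show "f x = 0 x"
        using abs_le_dual_norm[OF S f, of x] dual_spaceD(1)[OF f, of x] 0 by (cases "x \<in> S") auto
    qed
  next
    assume "f = 0"
    then have "dual_norm S N f \<le> 0"
      by (intro dual_norm_le) (use normed_space_onD[OF S] in auto)
    then show "dual_norm S N f = 0"
      using dual_norm_nonneg[OF S f] by simp
  qed
next
  fix f c assume f: "f \<in> dual_space S N"
  \<comment> \<open>Proved for every scalar and functional, so that scaling back by
    \<open>inverse c\<close> yields the reverse inequality.\<close>
  have le: "dual_norm S N (c *\<^sub>R f) \<le> \<bar>c\<bar> * dual_norm S N f" if f: "f \<in> dual_space S N" for c f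
  proof (rule dual_norm_le)
    fix x assume x: "x \<in> S"
    show "\<bar>(c *\<^sub>R f) x\<bar> \<le> \<bar>c\<bar> * dual_norm S N f * N x"
      using mult_left_mono[OF abs_le_dual_norm[OF S f x], of "\<bar>c\<bar>"]
      by (simp add: abs_mult algebra_simps)
  qed (use normed_space_onD[OF S] dual_norm_nonneg[OF S f] in auto)
  show "dual_norm S N (c *\<^sub>R f) = \<bar>c\<bar> * dual_norm S N f"
  proof (cases "c = 0")
    case True
    then show ?thesis
      using le[OF f, of 0] dual_norm_nonneg[OF S subspace_scale[OF subspace_dual_space[OF S] f], of 0]
      by simp
  next
    case False
    have "dual_norm S N (inverse c *\<^sub>R (c *\<^sub>R f)) \<le> \<bar>inverse c\<bar> * dual_norm S N (c *\<^sub>R f)"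
      by (rule le[OF subspace_scale[OF subspace_dual_space[OF S] f]])
    then have "\<bar>c\<bar> * dual_norm S N f \<le> dual_norm S N (c *\<^sub>R f)"
      using False by (simp add: field_simps)
    then show ?thesis
      using le[OF f, of c] by simp
  qed
next
  fix f g assume f: "f \<in> dual_space S N" and g: "g \<in> dual_space S N"
  show "dual_norm S N (f + g) \<le> dual_norm S N f + dual_norm S N g"
  proof (rule dual_norm_le)
    fix x assume x: "x \<in> S"
    show "\<bar>(f + g) x\<bar> \<le> (dual_norm S N f + dual_norm S N g) * N x"
      using abs_le_dual_norm[OF S f x] abs_le_dual_norm[OF S g x] by (simp add: algebra_simps)
  qed (use normed_space_onD[OF S] dual_norm_nonneg[OF S f] dual_norm_nonneg[OF S g] in auto)
qed

section \<open>L-orthogonal elements of the bidual\<close>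

lemma bidual_norm_L_orthogonal:
  assumes S: "normed_space_on S N" and F: "L_orthogonal_elem S N F"
  shows "bidual_norm S N F = 1"
proof -
  have "bidual_embed S N 0 = 0"
  proof
    fix f
    show "bidual_embed S N 0 f = 0 f"
      using dual_spaceD(3)[of f S N 0 0] normed_space_onD(6)[OF S] by (simp add: bidual_embed_def)
  qed
  moreover have "bidual_norm S N (bidual_embed S N 0 + F) = 1 + N 0"
    using F normed_space_onD(6)[OF S] by (auto simp: L_orthogonal_elem_def)
  ultimately show ?thesis
    using normed_space_onD(7)[OF S] by simp
qed

text \<open>Taking the vector 0 in the definition shows that \<open>F\<close> has norm one, so a
  pointwise bound on \<open>f\<close> transfers to \<open>F f\<close>. Later estimates of
  functionals are all pointwise and reach \<open>F\<close> in this way.\<close>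

lemma L_orthogonal_le:
  assumes S: "normed_space_on S N" and F: "L_orthogonal_elem S N F"
    and f: "f \<in> dual_space S N" and "0 \<le> C" "\<And>x. x \<in> S \<Longrightarrow> \<bar>f x\<bar> \<le> C * N x"
  shows "\<bar>F f\<bar> \<le> C"
proof -
  have "\<bar>F f\<bar> \<le> bidual_norm S N F * dual_norm S N f"
    using abs_le_dual_norm[OF normed_space_on_dual[OF S], of F f] F f
    by (simp add: bidual_norm_def bidual_space_def L_orthogonal_elem_def)
  moreover have "dual_norm S N f \<le> C"
    by (rule dual_norm_le) (use normed_space_onD[OF S] assms(4,5) in auto)
  ultimately show ?thesis
    using bidual_norm_L_orthogonal[OF S F] by simp
qed

text \<open>The norm \<open>1 + N x\<close> of \<open>x + F\<close> is almost attained at some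
  functional in the dual ball. There \<open>f x\<close> is at most \<open>N x\<close> and
  \<open>F f\<close> at most 1, so a sum close to \<open>1 + N x\<close> forces each of them close
  to its own maximum.\<close>

lemma L_orthogonal_witness:
  assumes S: "normed_space_on S N" and F: "L_orthogonal_elem S N F"
    and x: "x \<in> S" and e: "0 < e"
  obtains f where "f \<in> dual_space S N" "\<And>y. y \<in> S \<Longrightarrow> \<bar>f y\<bar> \<le> N y"
    "N x - e < f x" "1 - e < F f"
proof -
  let ?D = "dual_space S N"
  have "bidual_norm S N (bidual_embed S N x + F) = 1 + N x"
    using F x by (auto simp: L_orthogonal_elem_def)
  then have "1 + N x - e < (SUP f\<in>{f \<in> ?D. dual_norm S N f \<le> 1}. \<bar>(bidual_embed S N x + F) f\<bar>)"
    using e by (simp add: bidual_norm_def dual_norm_def)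
  moreover have ne: "{f \<in> ?D. dual_norm S N f \<le> 1} \<noteq> {}"
    using normed_space_onD(6,7)[OF normed_space_on_dual[OF S]] by force
  ultimately obtain f where f: "f \<in> ?D" "dual_norm S N f \<le> 1"
    and gt: "1 + N x - e < \<bar>(bidual_embed S N x + F) f\<bar>"
    by (metis (no_types, lifting) cSUP_least mem_Collect_eq not_le)
  have gt': "1 + N x - e < \<bar>f x + F f\<bar>"
    using gt f by (simp add: bidual_embed_def)
  \<comment> \<open>The norm involves an absolute value; this sign makes the nearly maximal value
    positive.\<close>
  define s :: real where "s = (if f x + F f \<ge> 0 then 1 else -1)"
  define h where "h = s *\<^sub>R f"
  have h: "h \<in> ?D"
    unfolding h_def by (rule subspace_scale[OF subspace_dual_space[OF S] f(1)])
  have Fh: "F h = s * F f"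
    using F f dual_spaceD(3)[of F ?D "dual_norm S N" f s]
    by (simp add: h_def L_orthogonal_elem_def bidual_space_def)
  have hle: "\<bar>h y\<bar> \<le> N y" if "y \<in> S" for y
  proof -
    have "\<bar>f y\<bar> \<le> 1 * N y"
      using abs_le_dual_norm[OF S f(1) that] mult_right_mono[OF f(2) normed_space_onD(2)[OF S that]]
      by linarith
    then show ?thesis by (simp add: h_def s_def)
  qed
  have "\<bar>F h\<bar> \<le> 1"
    by (rule L_orthogonal_le[OF S F h]) (use hle in auto)
  moreover have "\<bar>h x\<bar> \<le> N x" by (rule hle[OF x])
  moreover have "1 + N x - e < h x + F h"
    using gt' unfolding Fh by (auto simp: h_def s_def split: if_splits)
  ultimately show thesis
    using h hle by (intro that[of h]) auto
qed

section \<open>The space of locally finite graphs\<close>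

text \<open>
  A vector has its \<open>n\<close>-th sequence coordinate at \<open>{n}\<close>; the other coordinates are indexed by
  locally finite graphs on \<open>nat\<close>, coded as non-singleton sets of pairs.
\<close>

definition adjacent :: "nat set \<Rightarrow> nat \<Rightarrow> nat \<Rightarrow> bool" where
  "adjacent T m n \<longleftrightarrow> prod_encode (m, n) \<in> T \<or> prod_encode (n, m) \<in> T"

definition graph_codes :: "nat set set" where
  "graph_codes = {T. (\<forall>n. T \<noteq> {n}) \<and> (\<forall>m. finite {n. adjacent T m n})}"

text \<open>The finite set must be independent in the very graph whose coordinate is tested; this
  coupling makes the functionals that almost norm a graph coordinate sensitive to that graph. Loops
  are disregarded, since the codes of partitions contain them.\<close>

definition tests :: "(nat set \<times> nat set) set" where
  "tests = {(T, A). T \<in> graph_codes \<and> finite A \<and> (\<forall>m\<in>A. \<forall>n\<in>A. m \<noteq> n \<longrightarrow> \<not> adjacent T m n)}"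

definition test_val :: "nat set \<times> nat set \<Rightarrow> (nat set \<Rightarrow> real) \<Rightarrow> real" where
  "test_val = (\<lambda>(T, A) x. \<bar>x T\<bar> + (\<Sum>n\<in>A. \<bar>x {n}\<bar>))"

definition graph_space :: "(nat set \<Rightarrow> real) set" where
  "graph_space =
     {x. (\<forall>T. T \<notin> graph_codes \<and> (\<forall>n. T \<noteq> {n}) \<longrightarrow> x T = 0) \<and>
         (\<exists>C. \<forall>t\<in>tests. test_val t x \<le> C)}"

definition graph_norm :: "(nat set \<Rightarrow> real) \<Rightarrow> real" where
  "graph_norm x = (SUP t\<in>tests. test_val t x)"

section \<open>The graph norm\<close>

lemma graph_spaceI:
  assumes "\<And>T. T \<notin> graph_codes \<Longrightarrow> (\<And>n. T \<noteq> {n}) \<Longrightarrow> x T = 0"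
    "\<And>t. t \<in> tests \<Longrightarrow> test_val t x \<le> C"
  shows "x \<in> graph_space"
  using assms unfolding graph_space_def by blast

lemma graph_space_outside:
  "x \<in> graph_space \<Longrightarrow> T \<notin> graph_codes \<Longrightarrow> (\<And>n. T \<noteq> {n}) \<Longrightarrow> x T = 0"
  by (simp add: graph_space_def)

lemma empty_in_graph_codes: "{} \<in> graph_codes"
  by (auto simp: graph_codes_def adjacent_def)

lemma singleton_notin_graph_codes: "{n} \<notin> graph_codes"
  by (simp add: graph_codes_def)

text \<open>In the empty graph every finite set is independent, so the norm dominates the full
  \<open>l1\<close> sum of the sequence coordinates.\<close>

lemma empty_test: "finite A \<Longrightarrow> ({}, A) \<in> tests"
  by (simp add: tests_def empty_in_graph_codes adjacent_def)

lemma code_test: "T \<in> graph_codes \<Longrightarrow> (T, {}) \<in> tests"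
  by (simp add: tests_def)

lemma graph_norm_le: "(\<And>t. t \<in> tests \<Longrightarrow> test_val t x \<le> C) \<Longrightarrow> graph_norm x \<le> C"
  unfolding graph_norm_def using empty_test[of "{}"] by (intro cSUP_least) auto

lemma test_val_le_graph_norm:
  assumes "x \<in> graph_space" "t \<in> tests"
  shows "test_val t x \<le> graph_norm x"
proof -
  obtain C where "\<And>t. t \<in> tests \<Longrightarrow> test_val t x \<le> C"
    using assms(1) unfolding graph_space_def by blast
  then show ?thesis
    unfolding graph_norm_def by (intro cSUP_upper assms(2) bdd_aboveI) auto
qed

lemma test_val_add: "test_val t (x + y) \<le> test_val t x + test_val t y"
proof (cases t)
  case (Pair T A)
  have "(\<Sum>n\<in>A. \<bar>(x + y) {n}\<bar>) \<le> (\<Sum>n\<in>A. \<bar>x {n}\<bar> + \<bar>y {n}\<bar>)"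
    by (intro sum_mono) auto
  then show ?thesis
    using abs_triangle_ineq[of "x T" "y T"] by (simp add: Pair test_val_def sum.distrib)
qed

lemma test_val_scaleR: "test_val t (c *\<^sub>R x) = \<bar>c\<bar> * test_val t x"
  by (cases t) (simp add: test_val_def abs_mult sum_distrib_left distrib_left)

lemma test_val_add_le:
  assumes "x \<in> graph_space" "y \<in> graph_space" "t \<in> tests"
  shows "test_val t (x + y) \<le> graph_norm x + graph_norm y"
  by (intro order_trans[OF test_val_add] add_mono test_val_le_graph_norm assms)

lemma abs_code_le: "x \<in> graph_space \<Longrightarrow> T \<in> graph_codes \<Longrightarrow> \<bar>x T\<bar> \<le> graph_norm x"
  using test_val_le_graph_norm[OF _ code_test, of x T] by (simp add: test_val_def)

lemma sum_singletons_le: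
  assumes "x \<in> graph_space" "finite A"
  shows "(\<Sum>n\<in>A. \<bar>x {n}\<bar>) \<le> graph_norm x"
  using test_val_le_graph_norm[OF assms(1) empty_test[OF assms(2)]]
  by (simp add: test_val_def)

lemma abs_coord_le: "x \<in> graph_space \<Longrightarrow> \<bar>x T\<bar> \<le> graph_norm x"
proof (cases "T \<in> graph_codes \<or> (\<exists>n. T = {n})")
  case True
  assume "x \<in> graph_space"
  then show ?thesis
    using True abs_code_le[of x T] sum_singletons_le[of x "{n}" for n] by fastforce
next
  case False
  assume x: "x \<in> graph_space"
  then have "x T = 0"
    using False by (intro graph_space_outside) auto
  \<comment> \<open>The coordinate at \<open>{}\<close> shows that the norm is nonnegative.\<close>
  then show ?thesis
    using abs_code_le[OF x empty_in_graph_codes] by linarith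
qed

lemma graph_space_scaleR: "x \<in> graph_space \<Longrightarrow> c *\<^sub>R x \<in> graph_space"
  by (intro graph_spaceI[where C = "\<bar>c\<bar> * graph_norm x"])
    (auto simp: graph_space_outside test_val_scaleR intro!: mult_left_mono test_val_le_graph_norm)

lemma normed_space_on_graph: "normed_space_on graph_space graph_norm"
  unfolding normed_space_on_def
proof (intro conjI ballI allI)
  show sub: "subspace graph_space"
  proof (rule subspaceI)
    show "0 \<in> graph_space"
      by (rule graph_spaceI[where C = 0]) (auto simp: test_val_def)
  next
    fix x y assume xy: "x \<in> graph_space" "y \<in> graph_space"
    show "x + y \<in> graph_space"
      using test_val_add_le[OF xy] by (rule graph_spaceI[rotated]) (simp_all add: graph_space_outside xy)
  next
    fix c :: real and x assume "x \<in> graph_space"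
    then show "c *\<^sub>R x \<in> graph_space"
      by (rule graph_space_scaleR)
  qed
next
  fix x assume x: "x \<in> graph_space"
  show "0 \<le> graph_norm x"
    using abs_coord_le[OF x, of "{}"] by linarith
  show "graph_norm x = 0 \<longleftrightarrow> x = 0"
  proof
    assume "graph_norm x = 0"
    then show "x = 0"
      using abs_coord_le[OF x] by (auto simp: fun_eq_iff)
  next
    assume "x = 0"
    then show "graph_norm x = 0"
      using graph_norm_le[of x 0] abs_coord_le[OF x, of "{}"]
      by (force simp: test_val_def)
  qed
next
  fix c :: real and x assume x: "x \<in> graph_space"
  have sub: "c *\<^sub>R x \<in> graph_space"
    using x by (rule graph_space_scaleR)
  have 1: "graph_norm (c *\<^sub>R x) \<le> \<bar>c\<bar> * graph_norm x"
    by (intro graph_norm_le)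
      (auto simp: test_val_scaleR x intro!: mult_left_mono test_val_le_graph_norm)
  have 2: "\<bar>c\<bar> * graph_norm x \<le> graph_norm (c *\<^sub>R x)"
  proof (cases "c = 0")
    case True
    then show ?thesis using abs_coord_le[OF sub, of "{}"] by simp
  next
    case False
    have "graph_norm x \<le> graph_norm (c *\<^sub>R x) / \<bar>c\<bar>"
      using False test_val_le_graph_norm[OF sub]
      by (intro graph_norm_le) (simp add: field_simps test_val_scaleR)
    then show ?thesis using False by (simp add: field_simps)
  qed
  show "graph_norm (c *\<^sub>R x) = \<bar>c\<bar> * graph_norm x"
    using 1 2 by simp
next
  fix x y assume "x \<in> graph_space" "y \<in> graph_space"
  then show "graph_norm (x + y) \<le> graph_norm x + graph_norm y"
    by (intro graph_norm_le test_val_add_le)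
qed

lemmas graph_normD = normed_space_onD[OF normed_space_on_graph]

section \<open>Completeness\<close>

lemma tendsto_test_val:
  assumes "\<And>T. (\<lambda>n. x n T) \<longlonglongrightarrow> l T"
  shows "(\<lambda>n. test_val t (x n)) \<longlonglongrightarrow> test_val t l"
  by (cases t) (auto simp: test_val_def intro!: tendsto_intros assms)

text \<open>The limit is taken coordinatewise. A test value involves finitely many coordinates, so a
  Cauchy bound on \<open>x n - x m\<close> survives the limit in \<open>m\<close>, with an
  \<open>M\<close> that works for all tests at once.\<close>

lemma banach_space_on_graph: "banach_space_on graph_space graph_norm"
  unfolding banach_space_on_def
proof (intro conjI normed_space_on_graph allI impI, elim conjE)
  fix x :: "nat \<Rightarrow> nat set \<Rightarrow> real"
  assume "\<forall>n. x n \<in> graph_space"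
    and cauchy: "\<forall>e>0. \<exists>M. \<forall>m\<ge>M. \<forall>n\<ge>M. graph_norm (x m - x n) < e"
  then have x: "x n \<in> graph_space" for n by simp
  have diff: "x m - x n \<in> graph_space" for m n
    by (intro subspace_diff graph_normD(1) x)
  have "convergent (\<lambda>n. x n T)" for T
    unfolding Cauchy_convergent_iff[symmetric]
  proof (rule metric_CauchyI)
    fix e :: real assume "0 < e"
    then obtain M where "\<And>m n. m \<ge> M \<Longrightarrow> n \<ge> M \<Longrightarrow> graph_norm (x m - x n) < e"
      using cauchy by blast
    moreover have "dist (x m T) (x n T) \<le> graph_norm (x m - x n)" for m n
      using abs_coord_le[OF diff, of m n T] by (simp add: dist_real_def)
    ultimately show "\<exists>M. \<forall>m\<ge>M. \<forall>n\<ge>M. dist (x m T) (x n T) < e"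
      by (meson le_less_trans)
  qed
  then obtain l where l: "(\<lambda>n. x n T) \<longlonglongrightarrow> l T" for T
    unfolding convergent_def by metis
  have limit_bound: "\<exists>M. \<forall>n\<ge>M. \<forall>t\<in>tests. test_val t (x n - l) \<le> e" if "0 < e" for e
  proof -
    obtain M where M: "\<And>m n. m \<ge> M \<Longrightarrow> n \<ge> M \<Longrightarrow> graph_norm (x m - x n) < e"
      using cauchy \<open>0 < e\<close> by blast
    have "test_val t (x n - l) \<le> e" if "n \<ge> M" "t \<in> tests" for n t
    proof (rule LIMSEQ_le_const2)
      show "(\<lambda>m. test_val t (x n - x m)) \<longlonglongrightarrow> test_val t (x n - l)"
        by (intro tendsto_test_val) (auto intro!: tendsto_intros l)
      show "\<exists>N. \<forall>m\<ge>N. test_val t (x n - x m) \<le> e"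
        using M[OF that(1)] test_val_le_graph_norm[OF diff that(2)]
        by (meson less_imp_le order_trans)
    qed
    then show ?thesis by blast
  qed
  have l_outside: "l T = 0" if "T \<notin> graph_codes" "\<And>n. T \<noteq> {n}" for T
    using graph_space_outside[OF x that] LIMSEQ_unique[OF l[of T], of 0] by simp
  obtain M where M: "\<forall>n\<ge>M. \<forall>t\<in>tests. test_val t (x n - l) \<le> 1"
    using limit_bound[of 1] by auto
  have "x M - l \<in> graph_space"
    using M by (intro graph_spaceI[where C = 1]) (auto simp: l_outside graph_space_outside[OF x])
  then have "x M - (x M - l) \<in> graph_space"
    by (rule subspace_diff[OF graph_normD(1) x])
  moreover have "x M - (x M - l) = l" by auto
  ultimately have lS: "l \<in> graph_space" by metis
  have "(\<lambda>n. graph_norm (x n - l)) \<longlonglongrightarrow> 0"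
  proof (rule LIMSEQ_I)
    fix r :: real assume "0 < r"
    then obtain M where M: "\<forall>n\<ge>M. \<forall>t\<in>tests. test_val t (x n - l) \<le> r / 2"
      using limit_bound[of "r / 2"] by auto
    have "norm (graph_norm (x n - l) - 0) < r" if "n \<ge> M" for n
    proof -
      have "graph_norm (x n - l) \<le> r / 2"
        using M that by (intro graph_norm_le) auto
      moreover have "0 \<le> graph_norm (x n - l)"
        by (intro graph_normD(2) subspace_diff graph_normD(1) x lS)
      ultimately show ?thesis using \<open>0 < r\<close> by simp
    qed
    then show "\<exists>M. \<forall>n\<ge>M. norm (graph_norm (x n - l) - 0) < r" by blast
  qed
  then show "\<exists>l\<in>graph_space. (\<lambda>n. graph_norm (x n - l)) \<longlonglongrightarrow> 0"
    using lS by blast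
qed

section \<open>Unit vectors and the L-orthogonal sequence\<close>

lemma summable_singletons:
  assumes "x \<in> graph_space"
  shows "summable (\<lambda>n. \<bar>x {n}\<bar>)" "(\<Sum>n. \<bar>x {n}\<bar>) \<le> graph_norm x"
proof -
  show "summable (\<lambda>n. \<bar>x {n}\<bar>)"
    by (rule bounded_imp_summable[where B = "graph_norm x"])
      (auto intro: sum_singletons_le[OF assms])
  then show "(\<Sum>n. \<bar>x {n}\<bar>) \<le> graph_norm x"
    by (rule suminf_le_const) (auto intro: sum_singletons_le[OF assms])
qed

definition unit_vec :: "nat set \<Rightarrow> nat set \<Rightarrow> real" where
  "unit_vec T = (\<lambda>U. of_bool (U = T))"

lemma unit_vec_singleton_apply: "unit_vec {n} {m} = of_bool (m = n)"
  by (simp add: unit_vec_def)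

lemma unit_vec_code_apply_singleton: "T \<in> graph_codes \<Longrightarrow> unit_vec T {m} = 0"
  using singleton_notin_graph_codes by (auto simp: unit_vec_def)

lemma unit_vec_singleton_apply_code: "T \<in> graph_codes \<Longrightarrow> unit_vec {m} T = 0"
  using singleton_notin_graph_codes by (auto simp: unit_vec_def)

lemma test_val_unit_vec_le:
  assumes "t \<in> tests"
  shows "test_val t (unit_vec T) \<le> 1"
proof -
  obtain U A where t: "t = (U, A)" by force
  have A: "finite A" "U \<in> graph_codes" using assms by (auto simp: t tests_def)
  show ?thesis
  proof (cases "\<exists>n. T = {n}")
    case True
    then obtain n where T: "T = {n}" by blast
    have "(\<Sum>m\<in>A. \<bar>unit_vec T {m}\<bar>) = (\<Sum>m\<in>A. if m = n then 1 else 0)"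
      by (intro sum.cong) (auto simp: T unit_vec_singleton_apply)
    then show ?thesis
      using A by (simp add: t test_val_def T unit_vec_singleton_apply_code)
  next
    case False
    then have "(\<Sum>m\<in>A. \<bar>unit_vec T {m}\<bar>) = 0"
      by (intro sum.neutral) (auto simp: unit_vec_def)
    then show ?thesis by (simp add: t test_val_def unit_vec_def)
  qed
qed

lemma unit_vec_in_graph_space:
  assumes "T \<in> graph_codes \<or> (\<exists>n. T = {n})"
  shows "unit_vec T \<in> graph_space"
  using assms by (intro graph_spaceI[where C = 1] test_val_unit_vec_le) (auto simp: unit_vec_def)

lemma graph_norm_unit_vec_le: "graph_norm (unit_vec T) \<le> 1"
  by (intro graph_norm_le test_val_unit_vec_le)

lemma L_orthogonal_seq_graph: "L_orthogonal_seq graph_space graph_norm (\<lambda>n. unit_vec {n})"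
  unfolding L_orthogonal_seq_def
proof (intro conjI allI ballI)
  fix n
  show e: "unit_vec {n} \<in> graph_space" for n
    by (rule unit_vec_in_graph_space) blast
  show "graph_norm (unit_vec {n}) \<le> 1"
    by (rule graph_norm_unit_vec_le)
  fix x assume x: "x \<in> graph_space"
  have x0: "(\<lambda>n. x {n}) \<longlonglongrightarrow> 0"
    using summable_LIMSEQ_zero[OF summable_singletons(1)[OF x]] tendsto_rabs_zero_iff by blast
  show "(\<lambda>n. graph_norm (x + unit_vec {n})) \<longlonglongrightarrow> 1 + graph_norm x"
  proof (rule LIMSEQ_I)
    fix r :: real assume "0 < r"
    have "graph_norm x - r / 2 < (SUP t\<in>tests. test_val t x)"
      using \<open>0 < r\<close> by (simp add: graph_norm_def)
    then obtain t where t: "t \<in> tests" "graph_norm x - r / 2 < test_val t x"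
      using graph_norm_le[of x "graph_norm x - r / 2"] \<open>0 < r\<close>
      by (metis graph_norm_def not_less)
    obtain T A where tA: "t = (T, A)" by force
    have T: "T \<in> graph_codes" and A: "finite A"
      using t by (auto simp: tA tests_def)
    \<comment> \<open>Local finiteness of \<open>T\<close>: all but finitely many points lie outside
      \<open>A\<close> and are adjacent to none of its points.\<close>
    have "finite (A \<union> (\<Union>m\<in>A. {n. adjacent T m n}))"
      using T A by (auto simp: graph_codes_def)
    then obtain M1 where "A \<union> (\<Union>m\<in>A. {n. adjacent T m n}) \<subseteq> {..<M1}"
      using finite_nat_bounded by blast
    then have M1: "\<And>n. n \<in> A \<union> (\<Union>m\<in>A. {n. adjacent T m n}) \<Longrightarrow> n < M1"
      by blast
    obtain M2 where M2: "\<And>n. n \<ge> M2 \<Longrightarrow> \<bar>x {n}\<bar> < r / 2"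
      using LIMSEQ_D[OF x0, of "r / 2"] \<open>0 < r\<close> by auto
    have "norm (graph_norm (x + unit_vec {n}) - (1 + graph_norm x)) < r" if n: "n \<ge> max M1 M2" for n
    proof -
      have far: "n \<notin> A" "\<And>m. m \<in> A \<Longrightarrow> \<not> adjacent T m n"
        using M1[of n] n by auto
      have "(T, insert n A) \<in> tests"
        using t far by (auto simp: tA tests_def adjacent_def)
      then have "test_val (T, insert n A) (x + unit_vec {n}) \<le> graph_norm (x + unit_vec {n})"
        by (intro test_val_le_graph_norm subspace_add graph_normD(1) x e)
      moreover have "(\<Sum>m\<in>A. \<bar>x {m} + unit_vec {n} {m}\<bar>) = (\<Sum>m\<in>A. \<bar>x {m}\<bar>)"
        using far by (intro sum.cong) (auto simp: unit_vec_singleton_apply)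
      moreover have "\<bar>x {n}\<bar> < r / 2" using M2 n by simp
      \<comment> \<open>One half of \<open>r\<close> is lost in the choice of \<open>t\<close>, the
        other in replacing \<open>\<bar>x {n} + 1\<bar>\<close> by 1.\<close>
      ultimately have "graph_norm x + 1 - r < graph_norm (x + unit_vec {n})"
        using t far A T
        by (simp add: tA test_val_def unit_vec_singleton_apply unit_vec_singleton_apply_code)
      moreover have "graph_norm (x + unit_vec {n}) \<le> 1 + graph_norm x"
        using graph_normD(5)[OF x e, of n] graph_norm_unit_vec_le[of "{n}"] by simp
      ultimately show ?thesis using \<open>0 < r\<close> by simp
    qed
    then show "\<exists>M. \<forall>n\<ge>M. norm (graph_norm (x + unit_vec {n}) - (1 + graph_norm x)) < r"
      by blast
  qed
qed

section \<open>The variation of an L-orthogonal element\<close>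

lemma unit_vec_singleton_in_graph_space: "unit_vec {n} \<in> graph_space"
  by (rule unit_vec_in_graph_space) blast

lemma unit_vec_code_in_graph_space: "T \<in> graph_codes \<Longrightarrow> unit_vec T \<in> graph_space"
  by (rule unit_vec_in_graph_space) blast

text \<open>The norm depends monotonically on the absolute values of the coordinates. Hence
  reflecting a coordinate, deleting the sequence part or deleting one graph coordinate does not
  increase it.\<close>

lemma graph_norm_mono:
  assumes "x \<in> graph_space" "\<And>T. \<bar>y T\<bar> \<le> \<bar>x T\<bar>"
  shows "y \<in> graph_space" "graph_norm y \<le> graph_norm x"
proof -
  have le: "test_val t y \<le> graph_norm x" if "t \<in> tests" for t
  proof -
    have "test_val t y \<le> test_val t x"
      by (cases t) (auto simp: test_val_def intro!: add_mono sum_mono assms(2))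
    then show ?thesis
      using test_val_le_graph_norm[OF assms(1) that] by linarith
  qed
  have "y T = 0" if "T \<notin> graph_codes" "\<And>n. T \<noteq> {n}" for T
    using graph_space_outside[OF assms(1) that] assms(2)[of T] by simp
  then show "y \<in> graph_space"
    using le by (rule graph_spaceI)
  show "graph_norm y \<le> graph_norm x"
    using le by (rule graph_norm_le)
qed

text \<open>The pairing of bounded with absolutely summable sequences. It maps the bounded sequences
  into the dual, where \<open>F\<close> acts on them as a signed finitely additive measure; the
  value 0 off the carrier is the convention of \<open>dual_space\<close>.\<close>

definition seq_functional :: "(nat \<Rightarrow> real) \<Rightarrow> (nat set \<Rightarrow> real) \<Rightarrow> real" where
  "seq_functional g = (\<lambda>x. if x \<in> graph_space then \<Sum>n. g n * x {n} else 0)"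

lemma seq_functional_summable:
  assumes "\<And>n. \<bar>g n\<bar> \<le> C" "x \<in> graph_space"
  shows "summable (\<lambda>n. \<bar>g n * x {n}\<bar>)" "summable (\<lambda>n. g n * x {n})"
proof -
  show "summable (\<lambda>n. \<bar>g n * x {n}\<bar>)"
    by (rule summable_comparison_test'[OF summable_mult[OF summable_singletons(1)[OF assms(2)], of C]])
      (auto simp: abs_mult intro!: mult_right_mono assms(1))
  then show "summable (\<lambda>n. g n * x {n})"
    by (rule summable_rabs_cancel)
qed

lemma abs_seq_functional_le:
  assumes "\<And>n. \<bar>g n\<bar> \<le> C" "x \<in> graph_space"
  shows "\<bar>seq_functional g x\<bar> \<le> C * graph_norm x"
proof -
  have "\<bar>\<Sum>n. g n * x {n}\<bar> \<le> (\<Sum>n. \<bar>g n * x {n}\<bar>)"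
    by (rule summable_rabs[OF seq_functional_summable(1)[OF assms]])
  also have "\<dots> \<le> (\<Sum>n. C * \<bar>x {n}\<bar>)"
    using seq_functional_summable(1)[OF assms] summable_mult[OF summable_singletons(1)[OF assms(2)]]
    by (intro suminf_le) (auto simp: abs_mult intro!: mult_right_mono assms(1))
  also have "\<dots> = C * (\<Sum>n. \<bar>x {n}\<bar>)"
    by (rule suminf_mult[OF summable_singletons(1)[OF assms(2)]])
  also have "\<dots> \<le> C * graph_norm x"
    using summable_singletons(2)[OF assms(2)] order_trans[OF abs_ge_zero assms(1)[of 0]]
    by (rule mult_left_mono)
  finally show ?thesis using assms(2) by (simp add: seq_functional_def)
qed

lemma seq_functional_in_dual:
  assumes "\<And>n. \<bar>g n\<bar> \<le> C"
  shows "seq_functional g \<in> dual_space graph_space graph_norm"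
proof (rule dual_spaceI[where C = C])
  fix x y assume xy: "x \<in> graph_space" "y \<in> graph_space"
  note sum = seq_functional_summable(2)[OF assms]
  have "x + y \<in> graph_space"
    by (intro subspace_add graph_normD(1) xy)
  then show "seq_functional g (x + y) = seq_functional g x + seq_functional g y"
    using suminf_add[OF sum[OF xy(1)] sum[OF xy(2)]] xy
    by (simp add: seq_functional_def distrib_left)
next
  fix x c assume x: "x \<in> graph_space"
  then have "(\<Sum>n. c * (g n * x {n})) = c * (\<Sum>n. g n * x {n})"
    by (intro suminf_mult seq_functional_summable(2)[OF assms])
  then show "seq_functional g (c *\<^sub>R x) = c * seq_functional g x"
    using x graph_space_scaleR[OF x, of c] by (simp add: seq_functional_def mult_ac)
qed (use abs_seq_functional_le[OF assms] in \<open>auto simp: seq_functional_def\<close>)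

lemma seq_functional_add:
  assumes "\<And>n. \<bar>g n\<bar> \<le> C" "\<And>n. \<bar>h n\<bar> \<le> D"
  shows "seq_functional (\<lambda>n. g n + h n) = seq_functional g + seq_functional h"
proof
  fix x
  show "seq_functional (\<lambda>n. g n + h n) x = (seq_functional g + seq_functional h) x"
    using suminf_add[OF seq_functional_summable(2)[of g, OF assms(1)]
        seq_functional_summable(2)[of h, OF assms(2)], of x x]
    by (simp add: seq_functional_def distrib_right)
qed

lemma seq_functional_singleton:
  assumes "x \<in> graph_space" "\<And>m. m \<noteq> n \<Longrightarrow> g m = 0"
  shows "seq_functional g x = g n * x {n}"
  using assms suminf_finite[of "{n}" "\<lambda>m. g m * x {m}"] by (simp add: seq_functional_def)

section \<open>The signed measure induced by \<open>F\<close> and its variation\<close>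

context
  fixes F :: "((nat set \<Rightarrow> real) \<Rightarrow> real) \<Rightarrow> real"
  assumes F: "L_orthogonal_elem graph_space graph_norm F"
begin

lemma L_orthogonal_in_bidual: "F \<in> dual_space (dual_space graph_space graph_norm) (dual_norm graph_space graph_norm)"
  using F by (simp add: L_orthogonal_elem_def bidual_space_def)

lemmas L_orthogonal_add = dual_spaceD(2)[OF L_orthogonal_in_bidual]
  and L_orthogonal_scaleR = dual_spaceD(3)[OF L_orthogonal_in_bidual]
  and L_orthogonal_diff = dual_space_diff[OF subspace_dual_space[OF normed_space_on_graph] L_orthogonal_in_bidual]
  and L_orthogonal_graph_le = L_orthogonal_le[OF normed_space_on_graph F]
  and L_orthogonal_graph_witness = L_orthogonal_witness[OF normed_space_on_graph F]
  and dual_diff = subspace_diff[OF subspace_dual_space[OF normed_space_on_graph]]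
  and dual_scaleR = subspace_scale[OF subspace_dual_space[OF normed_space_on_graph]]

lemma abs_L_orthogonal_seq_functional_le:
  assumes "\<And>n. \<bar>g n\<bar> \<le> C"
  shows "\<bar>F (seq_functional g)\<bar> \<le> C"
  using order_trans[OF abs_ge_zero assms[of 0]]
  by (intro L_orthogonal_graph_le seq_functional_in_dual[OF assms] abs_seq_functional_le[OF assms])

lemma L_orthogonal_seq_functional_add:
  assumes "\<And>n. \<bar>g n\<bar> \<le> C" "\<And>n. \<bar>h n\<bar> \<le> D"
  shows "F (seq_functional (\<lambda>n. g n + h n)) = F (seq_functional g) + F (seq_functional h)"
  unfolding seq_functional_add[OF assms]
  by (intro L_orthogonal_add seq_functional_in_dual[OF assms(1)] seq_functional_in_dual[OF assms(2)])

text \<open>Composing a functional \<open>f\<close> of the dual ball with the reflection of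
  coordinate \<open>n\<close> keeps it in the ball and changes \<open>F f\<close> by
  \<open>- 2 * f (unit_vec {n}) * F ?d\<close>. If \<open>F ?d\<close> were nonzero, an
  \<open>f\<close> almost norming \<open>unit_vec {n}\<close> or its negative, with
  \<open>F f\<close> close to 1, would be pushed above 1.\<close>

lemma L_orthogonal_coordinate_functional: "F (seq_functional (indicat_real {n})) = 0"
proof -
  let ?d = "seq_functional (indicat_real {n})"
  have d: "?d \<in> dual_space graph_space graph_norm"
    by (rule seq_functional_in_dual[where C = 1]) (simp add: indicator_def)
  note e = unit_vec_singleton_in_graph_space[of n]
  have "- s * F ?d \<le> 0" if s: "s = 1 \<or> s = -1" for s
  proof (rule ccontr)
    define r where "r = - s * F ?d"
    assume "\<not> - s * F ?d \<le> 0"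
    then have r: "0 < r" by (simp add: r_def)
    \<comment> \<open>The bound 1/2 keeps \<open>s * f (unit_vec {n})\<close> above 1/2; the bound
      \<open>r\<close> makes the gain exceed the error.\<close>
    define \<epsilon> where "\<epsilon> = min r (1 / 2)"
    have \<epsilon>: "0 < \<epsilon>" "\<epsilon> \<le> r" "\<epsilon> \<le> 1 / 2" using r by (auto simp: \<epsilon>_def)
    obtain f where f: "f \<in> dual_space graph_space graph_norm"
      and fle: "\<And>y. y \<in> graph_space \<Longrightarrow> \<bar>f y\<bar> \<le> graph_norm y"
      and fs: "graph_norm (s *\<^sub>R unit_vec {n}) - \<epsilon> < f (s *\<^sub>R unit_vec {n})"
      and Ff: "1 - \<epsilon> < F f"
      using L_orthogonal_graph_witness[OF graph_space_scaleR[OF e] \<epsilon>(1)] by metis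
    have "1 \<le> graph_norm (s *\<^sub>R unit_vec {n})"
      using abs_coord_le[OF graph_space_scaleR[OF e, of s], of "{n}"] s
      by (auto simp: unit_vec_def)
    then have c: "1 / 2 < s * f (unit_vec {n})"
      using fs \<epsilon> dual_spaceD(3)[OF f e, of s] by simp
    define f' where "f' = f - (2 * f (unit_vec {n})) *\<^sub>R ?d"
    have f': "f' \<in> dual_space graph_space graph_norm"
      unfolding f'_def by (intro dual_diff f dual_scaleR d)
    have "\<bar>F f'\<bar> \<le> 1"
    proof (rule L_orthogonal_graph_le[OF f'])
      fix x assume x: "x \<in> graph_space"
      \<comment> \<open>\<open>y\<close> is \<open>x\<close> with its \<open>n\<close>-th sequence
        coordinate negated, and \<open>f'\<close> at \<open>x\<close> is \<open>f\<close> at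
        \<open>y\<close>.\<close>
      define y where "y = x - (2 * x {n}) *\<^sub>R unit_vec {n}"
      have y: "\<bar>y T\<bar> \<le> \<bar>x T\<bar>" for T
        by (simp add: y_def unit_vec_def)
      have "f y = f x - (2 * x {n}) * f (unit_vec {n})"
        unfolding y_def
        using dual_space_diff[OF graph_normD(1) f x graph_space_scaleR[OF e]] dual_spaceD(3)[OF f e]
        by simp
      moreover have "f' x = f x - 2 * f (unit_vec {n}) * x {n}"
        using seq_functional_singleton[OF x, of n "indicat_real {n}"]
        by (simp add: f'_def)
      ultimately have "f' x = f y" by simp
      also have "\<bar>f y\<bar> \<le> 1 * graph_norm x"
        using fle[OF graph_norm_mono(1)[OF x y]] graph_norm_mono(2)[OF x y] by simp
      finally show "\<bar>f' x\<bar> \<le> 1 * graph_norm x" .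
    qed simp
    moreover have "F f' = F f - 2 * f (unit_vec {n}) * F ?d"
      unfolding f'_def by (simp add: L_orthogonal_diff[OF f dual_scaleR[OF d]] L_orthogonal_scaleR[OF d])
    ultimately have "- 2 * f (unit_vec {n}) * F ?d < \<epsilon>"
      using Ff by linarith
    moreover have "- 2 * f (unit_vec {n}) * F ?d = 2 * (s * f (unit_vec {n})) * r"
      using s by (auto simp: r_def)
    moreover have "1 * r < 2 * (s * f (unit_vec {n})) * r"
      using c r by (intro mult_strict_right_mono) auto
    ultimately show False using \<epsilon> by linarith
  qed
  from this[of 1] this[of "-1"] show ?thesis by simp
qed

text \<open>This is the total variation on \<open>A\<close> of the signed measure sending
  \<open>B\<close> to \<open>F (seq_functional (indicat_real B))\<close>, written as a supremum over
  sequences rather than over finite partitions of \<open>A\<close>.\<close>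

definition variation :: "nat set \<Rightarrow> real" where
  "variation A = (SUP g\<in>{g. \<forall>n. \<bar>g n\<bar> \<le> indicat_real A n}. F (seq_functional g))"

lemma variation_upper:
  assumes "\<And>n. \<bar>g n\<bar> \<le> indicat_real A n"
  shows "F (seq_functional g) \<le> variation A"
  unfolding variation_def
proof (rule cSUP_upper)
  show "bdd_above ((\<lambda>g. F (seq_functional g)) ` {g. \<forall>n. \<bar>g n\<bar> \<le> indicat_real A n})"
  proof (rule bdd_aboveI2)
    fix g :: "nat \<Rightarrow> real" assume "g \<in> {g. \<forall>n. \<bar>g n\<bar> \<le> indicat_real A n}"
    then have "\<bar>g n\<bar> \<le> 1" for n
      using order_trans[of "\<bar>g n\<bar>" "indicat_real A n" 1] by (simp add: indicator_def)
    from abs_L_orthogonal_seq_functional_le[of g, OF this] show "F (seq_functional g) \<le> 1" by simp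
  qed
qed (use assms in simp)

lemma variation_least:
  assumes "\<And>g. (\<And>n. \<bar>g n\<bar> \<le> indicat_real A n) \<Longrightarrow> F (seq_functional g) \<le> C"
  shows "variation A \<le> C"
  unfolding variation_def
proof (rule cSUP_least)
  show "{g. \<forall>n. \<bar>g n\<bar> \<le> indicat_real A n} \<noteq> {}"
    by (auto intro!: exI[of _ "\<lambda>_. 0"])
qed (use assms in blast)

lemma variation_le_1: "variation A \<le> 1"
proof (rule variation_least)
  fix g assume g: "\<And>n. \<bar>g n\<bar> \<le> indicat_real A n"
  have "\<bar>g n\<bar> \<le> 1" for n
    using g[of n] by (rule order_trans) (simp add: indicator_def)
  from abs_L_orthogonal_seq_functional_le[of g, OF this] show "F (seq_functional g) \<le> 1" by simp
qed

lemma variation_nonneg: "0 \<le> variation A"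
  using variation_upper[of "\<lambda>_. 0" A] abs_L_orthogonal_seq_functional_le[of "\<lambda>_. 0" 0] by simp

text \<open>A competitor on the union splits into its restrictions to the two sets, which gives one
  inequality. Competitors on disjoint sets add up to a competitor on the union, which gives the
  other.\<close>

lemma variation_additive:
  assumes "A \<inter> B = {}"
  shows "variation (A \<union> B) = variation A + variation B"
proof (rule antisym)
  show "variation (A \<union> B) \<le> variation A + variation B"
  proof (rule variation_least)
    fix g assume g: "\<And>n. \<bar>g n\<bar> \<le> indicat_real (A \<union> B) n"
    let ?gA = "\<lambda>n. g n * indicat_real A n" and ?gB = "\<lambda>n. g n * indicat_real B n"
    have gA: "\<bar>?gA n\<bar> \<le> indicat_real A n" and gB: "\<bar>?gB n\<bar> \<le> indicat_real B n" for n
      using g[of n] by (auto simp: indicator_def split: if_splits)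
    have "g = (\<lambda>n. ?gA n + ?gB n)"
    proof
      fix n show "g n = ?gA n + ?gB n"
        using g[of n] assms by (auto simp: indicator_def split: if_splits)
    qed
    then have "F (seq_functional g) = F (seq_functional (\<lambda>n. ?gA n + ?gB n))"
      by (rule arg_cong)
    also have "\<dots> = F (seq_functional ?gA) + F (seq_functional ?gB)"
      by (rule L_orthogonal_seq_functional_add[where C = 1 and D = 1])
        (use gA gB in \<open>auto intro: order_trans[OF _ indicator_le_1]\<close>)
    also have "\<dots> \<le> variation A + variation B"
      by (intro add_mono variation_upper gA gB)
    finally show "F (seq_functional g) \<le> variation A + variation B" .
  qed
next
  have "F (seq_functional g) + F (seq_functional h) \<le> variation (A \<union> B)"
    if g: "\<And>n. \<bar>g n\<bar> \<le> indicat_real A n" and h: "\<And>n. \<bar>h n\<bar> \<le> indicat_real B n" for g h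
  proof -
    have bounds: "\<bar>g n\<bar> \<le> 1" "\<bar>h n\<bar> \<le> 1" for n
      using order_trans[OF g indicator_le_1] order_trans[OF h indicator_le_1] by auto
    have "\<bar>g n + h n\<bar> \<le> indicat_real (A \<union> B) n" for n
      using g[of n] h[of n] assms by (cases "n \<in> A"; cases "n \<in> B") auto
    then have "F (seq_functional (\<lambda>n. g n + h n)) \<le> variation (A \<union> B)"
      by (rule variation_upper)
    then show ?thesis by (simp add: L_orthogonal_seq_functional_add[OF bounds])
  qed
  \<comment> \<open>The two suprema are taken one after the other: first over \<open>g\<close> with
    \<open>h\<close> fixed, then over \<open>h\<close>.\<close>
  then have "variation A \<le> variation (A \<union> B) - F (seq_functional h)"
    if "\<And>n. \<bar>h n\<bar> \<le> indicat_real B n" for h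
    using that by (intro variation_least) (simp add: le_diff_eq)
  then have "variation B \<le> variation (A \<union> B) - variation A"
    by (intro variation_least) (simp add: le_diff_eq add.commute)
  then show "variation A + variation B \<le> variation (A \<union> B)" by simp
qed

lemma variation_singleton: "variation {n} = 0"
proof (rule antisym[OF _ variation_nonneg], rule variation_least)
  fix g :: "nat \<Rightarrow> real" assume g: "\<And>m. \<bar>g m\<bar> \<le> indicat_real {n} m"
  let ?d = "seq_functional (indicat_real {n})"
  have d: "?d \<in> dual_space graph_space graph_norm"
    by (rule seq_functional_in_dual[where C = 1]) (simp add: indicator_def)
  have g0: "g m = 0" if "m \<noteq> n" for m
    using g[of m] that by (simp add: indicator_def)
  have "seq_functional g = g n *\<^sub>R ?d"
  proof
    fix x
    show "seq_functional g x = (g n *\<^sub>R ?d) x"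
    proof (cases "x \<in> graph_space")
      case True
      then show ?thesis
        using seq_functional_singleton[OF True g0] seq_functional_singleton[OF True, of n "indicat_real {n}"]
        by simp
    qed (simp add: seq_functional_def)
  qed
  then show "F (seq_functional g) \<le> 0"
    by (simp add: L_orthogonal_scaleR[OF d] L_orthogonal_coordinate_functional)
qed

lemma fa_measure_variation: "fa_measure variation"
proof -
  have "variation A = 0" if "finite A" for A
    using that
  proof (induction A)
    case empty
    show ?case using variation_additive[of "{}" "{}"] by simp
  next
    case (insert n A)
    then show ?case
      using variation_additive[of "{n}" A] by (simp add: variation_singleton)
  qed
  then show ?thesis
    by (simp add: fa_measure_def Measure_Space.additive_def variation_nonneg variation_additive)
qed

end

section \<open>Large selectors\<close>

text \<open>A set independent in \<open>T\<close> meets the clique \<open>B\<close> in at most one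
  point. So \<open>unit_vec T\<close> plus \<open>t\<close> times a signed sum of the unit vectors
  of \<open>B\<close> has norm at most \<open>1 + t\<close>, although its sequence part has
  \<open>l1\<close> norm \<open>t * card B\<close>. As \<open>h\<close> spends nearly 1 on
  \<open>unit_vec T\<close>, little more than \<open>t\<close> is left for the signed sum.\<close>

lemma clique_sum_le:
  assumes T: "T \<in> graph_codes" and h: "h \<in> dual_space graph_space graph_norm"
    and hle: "\<And>y. y \<in> graph_space \<Longrightarrow> \<bar>h y\<bar> \<le> graph_norm y"
    and hT: "1 - \<epsilon> < h (unit_vec T)" and "0 < \<epsilon>"
    and B: "finite B" "\<And>m n. m \<in> B \<Longrightarrow> n \<in> B \<Longrightarrow> m \<noteq> n \<Longrightarrow> adjacent T m n"
  shows "(\<Sum>n\<in>B. \<bar>h (unit_vec {n})\<bar>) \<le> 1 + \<epsilon> * card B"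
proof (cases "card B \<le> 1")
  \<comment> \<open>The choice of \<open>t\<close> below requires two points; for fewer, each
    summand being at most 1 suffices.\<close>
  case True
  have "\<bar>h (unit_vec {n})\<bar> \<le> 1" for n
    using hle[OF unit_vec_singleton_in_graph_space, of n] graph_norm_unit_vec_le[of "{n}"] by simp
  then have "(\<Sum>n\<in>B. \<bar>h (unit_vec {n})\<bar>) \<le> real (card B) * 1"
    by (rule sum_bounded_above)
  also have "\<dots> \<le> 1 + \<epsilon> * card B"
    using True \<open>0 < \<epsilon>\<close> by (simp add: add_increasing2)
  finally show ?thesis .
next
  case False
  \<comment> \<open>Balanced so that \<open>t * card B = 1 + t\<close>: tests that see the
    coordinate \<open>T\<close> and tests that do not obey the same bound.\<close>
  define t where "t = 1 / (real (card B) - 1)"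
  have t: "0 < t" "t * card B = 1 + t"
    using False by (auto simp: t_def field_simps)
  define v where "v n = (t * sgn (h (unit_vec {n}))) *\<^sub>R unit_vec {n}" for n
  define y where "y = unit_vec T + (\<Sum>n\<in>B. v n)"
  have v: "v n \<in> graph_space" for n
    unfolding v_def by (intro graph_space_scaleR unit_vec_singleton_in_graph_space)
  have sum_v: "(\<Sum>n\<in>B. v n) \<in> graph_space"
    by (intro subspace_sum graph_normD(1) v)
  have y: "y \<in> graph_space"
    unfolding y_def by (intro subspace_add graph_normD(1) unit_vec_code_in_graph_space T sum_v)
  have y_code: "y U = of_bool (U = T)" if "U \<in> graph_codes" for U
    using that by (simp add: y_def sum_fun_apply v_def unit_vec_singleton_apply_code)
      (simp add: unit_vec_def)
  have y_singleton: "y {m} = (if m \<in> B then t * sgn (h (unit_vec {m})) else 0)" for m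
    using B(1)
    by (simp add: y_def sum_fun_apply v_def unit_vec_code_apply_singleton[OF T] unit_vec_singleton_apply)
  have "graph_norm y \<le> 1 + t"
  proof (rule graph_norm_le)
    fix p assume p: "p \<in> tests"
    obtain U A where pUA: "p = (U, A)" by force
    have U: "U \<in> graph_codes" and A: "finite A"
      and indep: "\<And>m n. m \<in> A \<Longrightarrow> n \<in> A \<Longrightarrow> m \<noteq> n \<Longrightarrow> \<not> adjacent U m n"
      using p by (auto simp: pUA tests_def)
    have "(\<Sum>n\<in>A. \<bar>y {n}\<bar>) = (\<Sum>n\<in>A \<inter> B. \<bar>y {n}\<bar>)"
      using A by (intro sum.mono_neutral_right) (auto simp: y_singleton)
    also have "\<dots> \<le> card (A \<inter> B) * t"
      using t by (intro sum_bounded_above) (auto simp: y_singleton abs_mult sgn_if)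
    finally have sum_le: "(\<Sum>n\<in>A. \<bar>y {n}\<bar>) \<le> card (A \<inter> B) * t" .
    show "test_val p y \<le> 1 + t"
    proof (cases "U = T")
      case True
      have "m = n" if "m \<in> A \<inter> B" "n \<in> A \<inter> B" for m n
        using indep B(2) that True by blast
      then have "card (A \<inter> B) \<le> 1"
        by (auto simp: card_le_Suc0_iff_eq A)
      then have "real (card (A \<inter> B)) * t \<le> 1 * t"
        using t by (intro mult_right_mono) auto
      then show ?thesis
        using sum_le U True by (simp add: pUA test_val_def y_code)
    next
      case False
      have "real (card (A \<inter> B)) * t \<le> real (card B) * t"
        using t B(1) by (intro mult_right_mono) (auto intro: card_mono)
      then show ?thesis
        using sum_le U False t by (simp add: pUA test_val_def y_code mult.commute)
    qed
  qed
  then have "h y \<le> 1 + t" using hle[OF y] by linarith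
  moreover have "h y = h (unit_vec T) + t * (\<Sum>n\<in>B. \<bar>h (unit_vec {n})\<bar>)"
  proof -
    have "h (v n) = t * \<bar>h (unit_vec {n})\<bar>" for n
      using dual_spaceD(3)[OF h unit_vec_singleton_in_graph_space, of "t * sgn (h (unit_vec {n}))" n]
      by (simp add: v_def abs_sgn mult_ac)
    moreover have "h (\<Sum>n\<in>B. v n) = (\<Sum>n\<in>B. h (v n))"
      by (intro dual_space_sum[OF graph_normD(1) h] B(1) v)
    ultimately show ?thesis
      unfolding y_def
      by (simp add: dual_spaceD(2)[OF h unit_vec_code_in_graph_space[OF T] sum_v] sum_distrib_left)
  qed
  ultimately have "t * (\<Sum>n\<in>B. \<bar>h (unit_vec {n})\<bar>) \<le> t + \<epsilon>"
    using hT by linarith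
  also have "\<dots> \<le> t * (1 + \<epsilon> * card B)"
    using t \<open>0 < \<epsilon>\<close> by (simp add: distrib_left mult.left_commute[of t])
  finally show ?thesis using t(1) by simp
qed

text \<open>Each test sees a single graph coordinate, so on vectors without sequence part the norm
  is a supremum norm. With \<open>c\<close> the norm of \<open>z\<close>, both \<open>c\<close>
  times \<open>unit_vec T\<close> plus \<open>z\<close> and the same minus \<open>z\<close> have
  norm at most \<open>c\<close>. Since \<open>h\<close> is nearly \<open>c\<close> on the first
  summand, at most \<open>\<epsilon> * c\<close> remains for \<open>z\<close>.\<close>

lemma off_code_le:
  assumes T: "T \<in> graph_codes" and h: "h \<in> dual_space graph_space graph_norm"
    and hle: "\<And>y. y \<in> graph_space \<Longrightarrow> \<bar>h y\<bar> \<le> graph_norm y"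
    and hT: "1 - \<epsilon> < h (unit_vec T)"
    and z: "z \<in> graph_space" "\<And>n. z {n} = 0" "z T = 0"
  shows "\<bar>h z\<bar> \<le> \<epsilon> * graph_norm z"
proof -
  let ?c = "graph_norm z"
  have c: "0 \<le> ?c" by (rule graph_normD(2)[OF z(1)])
  have "?c * h (unit_vec T) + s * h z \<le> ?c" if s: "s = 1 \<or> s = -1" for s
  proof -
    note uT = unit_vec_code_in_graph_space[OF T]
    define y where "y = ?c *\<^sub>R unit_vec T + s *\<^sub>R z"
    have y: "y \<in> graph_space"
      unfolding y_def by (intro subspace_add graph_normD(1) graph_space_scaleR uT z)
    have "graph_norm y \<le> ?c"
    proof (rule graph_norm_le)
      fix p assume p: "p \<in> tests"
      obtain U A where pUA: "p = (U, A)" by force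
      have "\<bar>y U\<bar> \<le> ?c"
        using c s z abs_coord_le[OF z(1), of U] by (auto simp: y_def unit_vec_def)
      moreover have "y {n} = 0" for n
        using z(2) by (simp add: y_def unit_vec_code_apply_singleton[OF T])
      ultimately show "test_val p y \<le> ?c"
        by (simp add: pUA test_val_def)
    qed
    moreover have "h y = ?c * h (unit_vec T) + s * h z"
      unfolding y_def using dual_spaceD(2)[OF h graph_space_scaleR[OF uT] graph_space_scaleR[OF z(1)]]
        dual_spaceD(3)[OF h uT] dual_spaceD(3)[OF h z(1)] by simp
    ultimately show ?thesis using hle[OF y] by linarith
  qed
  from this[of 1] this[of "-1"] have "?c * h (unit_vec T) + \<bar>h z\<bar> \<le> ?c"
    by simp
  moreover have "?c * (1 - \<epsilon>) \<le> ?c * h (unit_vec T)"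
    using hT c by (intro mult_left_mono) auto
  ultimately show ?thesis by (simp add: algebra_simps)
qed

text \<open>The partial sums of the sequence part converge to it in norm, because the norm of a tail
  is at most its \<open>l1\<close> sum. On that part \<open>f\<close> is therefore determined by its
  values at the unit vectors, and only the graph part contributes to the error.\<close>

lemma dual_minus_seq_functional_le:
  assumes f: "f \<in> dual_space graph_space graph_norm"
    and fle: "\<And>y. y \<in> graph_space \<Longrightarrow> \<bar>f y\<bar> \<le> graph_norm y"
    and fz: "\<And>z. z \<in> graph_space \<Longrightarrow> (\<And>n. z {n} = 0) \<Longrightarrow> \<bar>f z\<bar> \<le> C * graph_norm z"
    and "0 \<le> C" and x: "x \<in> graph_space"
  shows "\<bar>f x - seq_functional (\<lambda>n. f (unit_vec {n})) x\<bar> \<le> C * graph_norm x"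
proof -
  let ?g = "\<lambda>n. f (unit_vec {n})"
  define z where "z = (\<lambda>U. if \<exists>n. U = {n} then 0 else x U)"
  have zx: "\<bar>z U\<bar> \<le> \<bar>x U\<bar>" for U
    by (simp add: z_def)
  have z: "z \<in> graph_space" "graph_norm z \<le> graph_norm x"
    using graph_norm_mono[OF x zx] by auto
  have fz_le: "\<bar>f z\<bar> \<le> C * graph_norm x"
  proof -
    have "\<bar>f z\<bar> \<le> C * graph_norm z"
      by (rule fz[OF z(1)]) (auto simp: z_def)
    also have "\<dots> \<le> C * graph_norm x"
      by (intro mult_left_mono z \<open>0 \<le> C\<close>)
    finally show ?thesis .
  qed
  have e: "x {n} *\<^sub>R unit_vec {n} \<in> graph_space" for n
    by (intro graph_space_scaleR unit_vec_singleton_in_graph_space)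
  have bound: "\<bar>f x - (\<Sum>n<k. ?g n * x {n})\<bar>
      \<le> C * graph_norm x + ((\<Sum>n. \<bar>x {n}\<bar>) - (\<Sum>n<k. \<bar>x {n}\<bar>))" for k
  proof -
    define q where "q = (\<Sum>n<k. x {n} *\<^sub>R unit_vec {n})"
    have q: "q \<in> graph_space"
      unfolding q_def by (intro subspace_sum graph_normD(1) e)
    have fq: "f q = (\<Sum>n<k. ?g n * x {n})"
      unfolding q_def
      by (simp add: dual_space_sum[OF graph_normD(1) f _ e]
          dual_spaceD(3)[OF f unit_vec_singleton_in_graph_space] mult.commute)
    \<comment> \<open>The tail of the sequence part, from index \<open>k\<close> on.\<close>
    define r where "r = x - q - z"
    have r: "r \<in> graph_space"
      unfolding r_def by (rule subspace_diff[OF graph_normD(1) subspace_diff[OF graph_normD(1) x q] z(1)])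
    have r_code: "r U = 0" if "U \<in> graph_codes" for U
      using that singleton_notin_graph_codes
      by (auto simp: r_def q_def z_def sum_fun_apply unit_vec_singleton_apply_code)
    have r_singleton: "r {m} = (if m < k then 0 else x {m})" for m
      by (auto simp: r_def q_def z_def sum_fun_apply unit_vec_singleton_apply)
    have "graph_norm r \<le> (\<Sum>n. \<bar>x {n}\<bar>) - (\<Sum>n<k. \<bar>x {n}\<bar>)"
    proof (rule graph_norm_le)
      fix p assume p: "p \<in> tests"
      obtain U A where pUA: "p = (U, A)" by force
      have U: "U \<in> graph_codes" and A: "finite A"
        using p by (auto simp: pUA tests_def)
      have "(\<Sum>n\<in>A. \<bar>r {n}\<bar>) = (\<Sum>n\<in>A - {..<k}. \<bar>r {n}\<bar>)"
        using A by (intro sum.mono_neutral_right) (auto simp: r_singleton)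
      also have "\<dots> = (\<Sum>n\<in>A - {..<k}. \<bar>x {n}\<bar>)"
        by (intro sum.cong) (auto simp: r_singleton)
      finally have "(\<Sum>n\<in>A. \<bar>r {n}\<bar>) + (\<Sum>n<k. \<bar>x {n}\<bar>) = (\<Sum>n\<in>(A - {..<k}) \<union> {..<k}. \<bar>x {n}\<bar>)"
        using A by (subst sum.union_disjoint) auto
      also have "\<dots> \<le> (\<Sum>n. \<bar>x {n}\<bar>)"
        using A by (intro sum_le_suminf summable_singletons(1)[OF x]) auto
      finally show "test_val p r \<le> (\<Sum>n. \<bar>x {n}\<bar>) - (\<Sum>n<k. \<bar>x {n}\<bar>)"
        using U by (simp add: pUA test_val_def r_code)
    qed
    moreover have "f r = f x - f q - f z"
      unfolding r_def using dual_space_diff[OF graph_normD(1) f]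
        subspace_diff[OF graph_normD(1) x q] x q z(1) by simp
    ultimately show ?thesis
      using fle[OF r] fz_le fq by linarith
  qed
  have g: "\<bar>?g n\<bar> \<le> 1" for n
    using fle[OF unit_vec_singleton_in_graph_space, of n] graph_norm_unit_vec_le[of "{n}"] by simp
  have "(\<lambda>k. \<bar>f x - (\<Sum>n<k. ?g n * x {n})\<bar>) \<longlonglongrightarrow> \<bar>f x - seq_functional ?g x\<bar>"
    using summable_LIMSEQ[OF seq_functional_summable(2)[of ?g, OF g x]] x
    by (auto simp: seq_functional_def intro!: tendsto_intros)
  moreover have "(\<lambda>k. C * graph_norm x + ((\<Sum>n. \<bar>x {n}\<bar>) - (\<Sum>n<k. \<bar>x {n}\<bar>)))
      \<longlonglongrightarrow> C * graph_norm x + ((\<Sum>n. \<bar>x {n}\<bar>) - (\<Sum>n. \<bar>x {n}\<bar>))"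
    by (intro tendsto_intros summable_LIMSEQ summable_singletons(1)[OF x])
  ultimately show ?thesis
    using bound by (auto dest: LIMSEQ_le)
qed

text \<open>The functional is the mean of witnesses for \<open>unit_vec T\<close> and for its
  negative. Averaging keeps \<open>F f\<close> close to 1 and preserves the clique bound, while the
  two nearly opposite values at \<open>unit_vec T\<close> cancel, so that \<open>f\<close> is small
  on all graph coordinates.\<close>

lemma L_orthogonal_functional:
  assumes F: "L_orthogonal_elem graph_space graph_norm F"
    and T: "T \<in> graph_codes" and \<epsilon>: "0 < \<epsilon>"
  obtains f where "f \<in> dual_space graph_space graph_norm"
    "\<And>y. y \<in> graph_space \<Longrightarrow> \<bar>f y\<bar> \<le> graph_norm y" "1 - \<epsilon> < F f"
    "\<And>z. z \<in> graph_space \<Longrightarrow> (\<And>n. z {n} = 0) \<Longrightarrow> \<bar>f z\<bar> \<le> 2 * \<epsilon> * graph_norm z"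
    "\<And>B. finite B \<Longrightarrow> (\<And>m n. m \<in> B \<Longrightarrow> n \<in> B \<Longrightarrow> m \<noteq> n \<Longrightarrow> adjacent T m n) \<Longrightarrow>
       (\<Sum>n\<in>B. \<bar>f (unit_vec {n})\<bar>) \<le> 1 + \<epsilon> * card B"
proof -
  note uT = unit_vec_code_in_graph_space[OF T]
  note scaleR_dual = subspace_scale[OF subspace_dual_space[OF normed_space_on_graph]]
  note diff_dual = subspace_diff[OF subspace_dual_space[OF normed_space_on_graph]]
  have norm_uT: "1 \<le> graph_norm (unit_vec T)"
    using abs_coord_le[OF uT, of T] by (simp add: unit_vec_def)
  obtain f1 where f1: "f1 \<in> dual_space graph_space graph_norm"
      "\<And>y. y \<in> graph_space \<Longrightarrow> \<bar>f1 y\<bar> \<le> graph_norm y"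
      "graph_norm (unit_vec T) - \<epsilon> < f1 (unit_vec T)" "1 - \<epsilon> < F f1"
    using L_orthogonal_witness[OF normed_space_on_graph F uT \<epsilon>] by metis
  obtain f2 where f2: "f2 \<in> dual_space graph_space graph_norm"
      "\<And>y. y \<in> graph_space \<Longrightarrow> \<bar>f2 y\<bar> \<le> graph_norm y"
      "graph_norm ((-1) *\<^sub>R unit_vec T) - \<epsilon> < f2 ((-1) *\<^sub>R unit_vec T)" "1 - \<epsilon> < F f2"
    using L_orthogonal_witness[OF normed_space_on_graph F graph_space_scaleR[OF uT] \<epsilon>] by metis
  \<comment> \<open>With this sign both \<open>f1\<close> and \<open>h\<close> almost norm
    \<open>unit_vec T\<close>, so the preceding estimates apply to both.\<close>
  define h where "h = (-1) *\<^sub>R f2"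
  have h: "h \<in> dual_space graph_space graph_norm"
    unfolding h_def by (rule scaleR_dual[OF f2(1)])
  have hle: "\<bar>h y\<bar> \<le> graph_norm y" if "y \<in> graph_space" for y
    using f2(2)[OF that] by (simp add: h_def)
  have hT: "1 - \<epsilon> < h (unit_vec T)"
    using f2(3) norm_uT dual_spaceD(3)[OF f2(1) uT, of "-1"] graph_normD(4)[OF uT, of "-1"]
    by (simp add: h_def)
  have f1T: "1 - \<epsilon> < f1 (unit_vec T)"
    using f1(3) norm_uT by simp
  define f where "f = (1 / 2) *\<^sub>R (f1 - h)"
  have f_apply: "f y = (f1 y - h y) / 2" for y
    by (simp add: f_def)
  show thesis
  proof (rule that)
    show f: "f \<in> dual_space graph_space graph_norm"
      unfolding f_def by (intro scaleR_dual diff_dual f1 h)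
    show "\<bar>f y\<bar> \<le> graph_norm y" if "y \<in> graph_space" for y
      using f1(2)[OF that] hle[OF that] by (simp add: f_apply abs_le_iff)
    have Fd: "F \<in> dual_space (dual_space graph_space graph_norm) (dual_norm graph_space graph_norm)"
      using F by (simp add: L_orthogonal_elem_def bidual_space_def)
    have "F f = (F f1 - F h) / 2"
      unfolding f_def
      using dual_spaceD(3)[OF Fd diff_dual[OF f1(1) h]]
        dual_space_diff[OF subspace_dual_space[OF normed_space_on_graph] Fd f1(1) h]
      by simp
    moreover have "F h = - F f2"
      unfolding h_def using dual_spaceD(3)[OF Fd f2(1), of "-1"] by simp
    ultimately show "1 - \<epsilon> < F f"
      using f1(4) f2(4) by simp
  next
    fix z assume z: "z \<in> graph_space" "\<And>n. z {n} = 0"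
    \<comment> \<open>Coordinate \<open>T\<close> is split off: there \<open>f1\<close> and
      \<open>h\<close> cancel, while on the rest each of them is small.\<close>
    define z' where "z' = z - z T *\<^sub>R unit_vec T"
    have z'z: "\<bar>z' U\<bar> \<le> \<bar>z U\<bar>" for U
      by (simp add: z'_def unit_vec_def)
    note z' = graph_norm_mono[OF z(1) z'z]
    have z'0: "z' {n} = 0" "z' T = 0" for n
      using z'z[of "{n}"] z(2)[of n] by (auto simp: z'_def unit_vec_def)
    have z'_le: "\<epsilon> * graph_norm z' \<le> \<epsilon> * graph_norm z"
      using z'(2) \<epsilon> by simp
    have b1: "\<bar>f1 z'\<bar> \<le> \<epsilon> * graph_norm z"
      by (rule order_trans[OF off_code_le[OF T f1(1) f1(2) f1T z'(1) z'0] z'_le])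
    have b2: "\<bar>h z'\<bar> \<le> \<epsilon> * graph_norm z"
      by (rule order_trans[OF off_code_le[OF T h hle hT z'(1) z'0] z'_le])
    have "\<bar>f1 (unit_vec T)\<bar> \<le> 1" "\<bar>h (unit_vec T)\<bar> \<le> 1"
      using f1(2)[OF uT] hle[OF uT] graph_norm_unit_vec_le[of T] by linarith+
    then have "\<bar>f1 (unit_vec T) - h (unit_vec T)\<bar> \<le> \<epsilon>"
      using f1T hT by linarith
    then have b3: "\<bar>z T * (f1 (unit_vec T) - h (unit_vec T))\<bar> \<le> graph_norm z * \<epsilon>"
      unfolding abs_mult using abs_coord_le[OF z(1), of T] graph_normD(2)[OF z(1)]
      by (intro mult_mono) auto
    have split: "g z = g z' + z T * g (unit_vec T)" if g: "g \<in> dual_space graph_space graph_norm" for g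
      using dual_space_diff[OF graph_normD(1) g z(1) graph_space_scaleR[OF uT], of "z T"]
        dual_spaceD(3)[OF g uT, of "z T"] by (simp add: z'_def)
    have "2 * f z = f1 z - h z"
      by (simp add: f_apply)
    also have "\<dots> = f1 z' - h z' + z T * (f1 (unit_vec T) - h (unit_vec T))"
      unfolding split[OF f1(1)] split[OF h] by (simp add: algebra_simps)
    finally have "2 * f z = f1 z' - h z' + z T * (f1 (unit_vec T) - h (unit_vec T))" .
    \<comment> \<open>Three errors of \<open>\<epsilon> * graph_norm z\<close> bound twice
      \<open>f z\<close>; the factor 3/2 is rounded up to 2.\<close>
    then have "\<bar>f z\<bar> \<le> 2 * (\<epsilon> * graph_norm z)"
      using b1 b2 b3 unfolding mult.commute[of "graph_norm z"] by linarith
    then show "\<bar>f z\<bar> \<le> 2 * \<epsilon> * graph_norm z"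
      by simp
  next
    fix B :: "nat set"
    assume B: "finite B" "\<And>m n. m \<in> B \<Longrightarrow> n \<in> B \<Longrightarrow> m \<noteq> n \<Longrightarrow> adjacent T m n"
    have "(\<Sum>n\<in>B. \<bar>f (unit_vec {n})\<bar>) \<le> (\<Sum>n\<in>B. (\<bar>f1 (unit_vec {n})\<bar> + \<bar>h (unit_vec {n})\<bar>) / 2)"
      by (intro sum_mono) (simp add: f_apply)
    also have "\<dots> = ((\<Sum>n\<in>B. \<bar>f1 (unit_vec {n})\<bar>) + (\<Sum>n\<in>B. \<bar>h (unit_vec {n})\<bar>)) / 2"
      by (simp add: sum.distrib flip: sum_divide_distrib)
    also have "\<dots> \<le> 1 + \<epsilon> * card B"
      using clique_sum_le[OF T f1(1) f1(2) f1T \<epsilon> B] clique_sum_le[OF T h hle hT \<epsilon> B] by simp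
    finally show "(\<Sum>n\<in>B. \<bar>f (unit_vec {n})\<bar>) \<le> 1 + \<epsilon> * card B" .
  qed
qed

section \<open>Selectors for partitions and the fit Q-measure\<close>

definition partition_code :: "(nat \<Rightarrow> nat set) \<Rightarrow> nat set" where
  "partition_code P = {prod_encode (m, n) | m n. \<exists>i. m \<in> P i \<and> n \<in> P i}"

lemma adjacent_partition_code: "adjacent (partition_code P) m n \<longleftrightarrow> (\<exists>i. m \<in> P i \<and> n \<in> P i)"
  by (auto simp: adjacent_def partition_code_def)

lemma partition_code_in_graph_codes:
  assumes P: "partition_on UNIV (range P)" and fin: "\<And>n. finite (P n)"
  shows "partition_code P \<in> graph_codes"
proof -
  have cover: "\<exists>i. m \<in> P i" for m
    using partition_onD1[OF P] by blast
  \<comment> \<open>A piece may occur under several indices, so only equality of the pieces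
    follows.\<close>
  have unique: "P i = P j" if "m \<in> P i" "m \<in> P j" for i j m
    using partition_onD2[OF P] that by (auto simp: disjoint_def)
  \<comment> \<open>The loops give the code more than one element, so it cannot be the index of a
    sequence coordinate.\<close>
  have "partition_code P \<noteq> {n}" for n
  proof
    assume eq: "partition_code P = {n}"
    have "prod_encode (m, m) = n" for m
    proof -
      have "prod_encode (m, m) \<in> partition_code P"
        using cover[of m] by (auto simp: partition_code_def)
      then show ?thesis using eq by simp
    qed
    then have "prod_encode (0, 0) = prod_encode (1, 1)" by metis
    then show False by simp
  qed
  moreover have "finite {n. adjacent (partition_code P) m n}" for m
  proof -
    obtain i where i: "m \<in> P i" using cover by blast
    have "{n. adjacent (partition_code P) m n} \<subseteq> P i"
      using unique[OF i] by (auto simp: adjacent_partition_code)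
    then show ?thesis using fin finite_subset by blast
  qed
  ultimately show ?thesis by (simp add: graph_codes_def)
qed

text \<open>The selector consists of the points where the sequence \<open>g\<close> of values of
  \<open>f\<close> at the unit vectors is not small. The clique bound limits its size in each piece,
  and \<open>F\<close> loses little when \<open>f\<close> is replaced by \<open>g\<close> and
  \<open>g\<close> is cut down to the selector.\<close>

lemma variation_large_selector:
  fixes P :: "nat \<Rightarrow> nat set"
  assumes F: "L_orthogonal_elem graph_space graph_norm F"
    and P: "partition_on UNIV (range P)" "\<And>n. finite (P n)" and \<delta>: "\<delta> < 1"
  shows "\<exists>A k. \<delta> \<le> variation F A \<and> (\<forall>n. card (P n \<inter> A) \<le> k)"
proof -
  \<comment> \<open>From \<open>F f > 1 - \<epsilon>\<close>, passing to \<open>g\<close> costs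
    \<open>2 * \<epsilon>\<close> and removing the part off \<open>A\<close> another
    \<open>2 * \<epsilon>\<close>; what is left exceeds
    \<open>1 - 8 * \<epsilon> = \<delta>\<close>.\<close>
  define \<epsilon> where "\<epsilon> = (1 - \<delta>) / 8"
  have \<epsilon>: "0 < \<epsilon>" using \<delta> by (simp add: \<epsilon>_def)
  let ?T = "partition_code P"
  obtain f where f: "f \<in> dual_space graph_space graph_norm"
    and fle: "\<And>y. y \<in> graph_space \<Longrightarrow> \<bar>f y\<bar> \<le> graph_norm y" and Ff: "1 - \<epsilon> < F f"
    and fz: "\<And>z. z \<in> graph_space \<Longrightarrow> (\<And>n. z {n} = 0) \<Longrightarrow> \<bar>f z\<bar> \<le> 2 * \<epsilon> * graph_norm z"
    and clique: "\<And>B. finite B \<Longrightarrow> (\<And>m n. m \<in> B \<Longrightarrow> n \<in> B \<Longrightarrow> m \<noteq> n \<Longrightarrow> adjacent ?T m n) \<Longrightarrow>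
       (\<Sum>n\<in>B. \<bar>f (unit_vec {n})\<bar>) \<le> 1 + \<epsilon> * card B"
    by (rule L_orthogonal_functional[OF F partition_code_in_graph_codes[OF P] \<epsilon>]) blast
  define g where "g n = f (unit_vec {n})" for n
  have g: "\<bar>g n\<bar> \<le> 1" for n
    using fle[OF unit_vec_singleton_in_graph_space, of n] graph_norm_unit_vec_le[of "{n}"]
    by (simp add: g_def)
  \<comment> \<open>The threshold is twice the slack per point in the clique bound, so the terms
    linear in the cardinality leave at most \<open>1 / \<epsilon>\<close> points in a piece.\<close>
  define A where "A = {n. 2 * \<epsilon> \<le> \<bar>g n\<bar>}"
  have "card (P i \<inter> A) \<le> nat \<lceil>1 / \<epsilon>\<rceil>" for i
  proof -
    have "card (P i \<inter> A) * (2 * \<epsilon>) \<le> (\<Sum>n\<in>P i \<inter> A. \<bar>g n\<bar>)"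
      by (rule sum_bounded_below) (auto simp: A_def)
    also have "\<dots> \<le> 1 + \<epsilon> * card (P i \<inter> A)"
      unfolding g_def by (rule clique) (auto simp: P(2) adjacent_partition_code)
    finally have "card (P i \<inter> A) \<le> 1 / \<epsilon>"
      using \<epsilon> by (simp add: field_simps)
    then show ?thesis by linarith
  qed
  moreover have "\<delta> \<le> variation F A"
  proof -
    let ?D = "dual_space graph_space graph_norm"
    let ?gA = "\<lambda>n. g n * indicat_real A n" and ?gB = "\<lambda>n. g n * indicat_real (- A) n"
    have gA: "\<bar>?gA n\<bar> \<le> indicat_real A n" and gB: "\<bar>?gB n\<bar> \<le> 2 * \<epsilon>" for n
      using g[of n] \<epsilon> by (auto simp: A_def indicator_def)
    have gA1: "\<bar>?gA n\<bar> \<le> 1" for n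
      using gA[of n] by (rule order_trans) (rule indicator_le_1)
    have Gg: "seq_functional g \<in> ?D"
      by (rule seq_functional_in_dual[OF g])
    have "\<bar>F (f - seq_functional g)\<bar> \<le> 2 * \<epsilon>"
    proof (rule L_orthogonal_le[OF normed_space_on_graph F])
      show "f - seq_functional g \<in> ?D"
        by (rule subspace_diff[OF subspace_dual_space[OF normed_space_on_graph] f Gg])
      fix x assume x: "x \<in> graph_space"
      have "\<bar>f x - seq_functional (\<lambda>n. f (unit_vec {n})) x\<bar> \<le> 2 * \<epsilon> * graph_norm x"
        by (rule dual_minus_seq_functional_le[OF f fle fz _ x]) (use \<epsilon> in simp_all)
      then show "\<bar>(f - seq_functional g) x\<bar> \<le> 2 * \<epsilon> * graph_norm x"
        unfolding g_def[abs_def] by simp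
    qed (use \<epsilon> in simp)
    moreover have "F (f - seq_functional g) = F f - F (seq_functional g)"
      by (rule L_orthogonal_diff[OF F f Gg])
    moreover have "F (seq_functional g) = F (seq_functional ?gA) + F (seq_functional ?gB)"
    proof -
      have "g = (\<lambda>n. ?gA n + ?gB n)"
        by (auto simp: indicator_def)
      then have "F (seq_functional g) = F (seq_functional (\<lambda>n. ?gA n + ?gB n))"
        by (rule arg_cong)
      then show ?thesis
        using L_orthogonal_seq_functional_add[of F ?gA 1 ?gB "2 * \<epsilon>", OF F gA1 gB] by simp
    qed
    moreover have "\<bar>F (seq_functional ?gB)\<bar> \<le> 2 * \<epsilon>"
      by (rule abs_L_orthogonal_seq_functional_le[OF F gB])
    moreover have "F (seq_functional ?gA) \<le> variation F A"
      by (rule variation_upper[OF F gA])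
    ultimately show ?thesis
      using Ff \<epsilon> by (simp add: \<epsilon>_def) argo
  qed
  ultimately show ?thesis by blast
qed

lemma fit_Q_measure_variation:
  assumes F: "L_orthogonal_elem graph_space graph_norm F"
  shows "fit_Q_measure (variation F)"
proof -
  have "\<exists>A k. \<delta> * variation F UNIV \<le> variation F A \<and> (\<forall>n. card (P n \<inter> A) \<le> k)"
    if "0 < \<delta>" "\<delta> < 1 / 2" "partition_on UNIV (range P)" "\<And>n. finite (P n)"
    for \<delta> and P :: "nat \<Rightarrow> nat set"
  proof -
    \<comment> \<open>The total variation is at most 1, so a selector of variation at least
      \<open>\<delta>\<close> is enough.\<close>
    have "\<delta> * variation F UNIV \<le> \<delta>"
      using mult_left_mono[OF variation_le_1[OF F, of UNIV], of \<delta>] that by simp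
    moreover have "\<exists>A k. \<delta> \<le> variation F A \<and> (\<forall>n. card (P n \<inter> A) \<le> k)"
      by (rule variation_large_selector[OF F]) (use that in auto)
    ultimately show ?thesis by (meson order_trans)
  qed
  moreover have "variation F UNIV \<noteq> 0"
  proof -
    \<comment> \<open>A selector for any one partition bounds the total variation from below; the
      partition into singletons is at hand.\<close>
    have "partition_on UNIV (range (\<lambda>n::nat. {n}))"
      by (auto simp: partition_on_def disjoint_def)
    then obtain A where "1 / 2 \<le> variation F A"
      using variation_large_selector[OF F, of "\<lambda>n. {n}" "1 / 2"] by auto
    moreover have "variation F UNIV = variation F A + variation F (- A)"
      using variation_additive[OF F, of A "- A"] by simp
    ultimately show ?thesis
      using variation_nonneg[OF F, of "- A"] by simp
  qed
  ultimately show ?thesis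
    using fa_measure_variation[OF F] by (auto simp: fit_Q_measure_def delta_fit_Q_measure_def)
qed

theorem theorem1p3:
  assumes "\<nexists>\<mu>. fit_Q_measure \<mu>"
  shows "\<exists>(X :: (nat set \<Rightarrow> real) set) (N :: (nat set \<Rightarrow> real) \<Rightarrow> real).
           banach_space_on X N \<and>
           (\<exists>u. L_orthogonal_seq X N u) \<and>
           \<not> (\<exists>F. L_orthogonal_elem X N F)"
  using assms banach_space_on_graph L_orthogonal_seq_graph fit_Q_measure_variation by blast

end
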